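(* Let $G=\mathbb{Z}\rtimes_\psi\mathbb{Z}/2\mathbb{Z}$, where $\mathbb{Z}/2\mathbb{Z}=\langle x\rangle=\{0,x\}$ and $\psi(x)(n)=-n$, with $\mathbb{Z}$ identified with the index-two normal subgroup $\mathbb{Z}\times\{0\}$. Let $(X_1,\mathbb{Z},T)$ be the topological dynamical system constructed in the context (for any choices made in the construction), and let $\left((X_1)_{\mathbb{Z}}^G,G,T^{\mathbb{Z}\backslash G}\right)$ be its co-induced system. Then $$h_{top}^*\left((X_1)_{\mathbb{Z}}^G,G,T^{\mathbb{Z}\backslash G}\right)=\log(2).$$
   Context: A topological dynamical system (t.d.s.) $(X,G,\alpha)$ consists of a compact metric space $X$, a group $G$, and an action $\alpha$ of $G$ on $X$ by homeomorphisms. A homeomorphism $T$ of $X$ gives the $\mathbb{Z}$-action $n\mapsto T^n$. $\mathbb{N}=\{1,2,\dots\}$. Maximal pattern entropy: for an open cover $\mathcal{U}$ of $X$, $N(\mathcal{U})$ is the minimal cardinality of a subcover; $p^*_{X,G,\mathcal{U}}(n)=\max_{(g_1,\dots,g_n)\in G^n}N\big(\bigvee_{i=1}^n\alpha_{g_i^{-1}}(\mathcal{U})\big)$; $h_{top}^*(\mathcal{U},G)=\lim_n\frac1n\log p^*_{X,G,\mathcal{U}}(n)$; and $h_{top}^*(X,G,\alpha)=\sup_{\mathcal{U}}h_{top}^*(\mathcal{U},G)$ over all open covers. Co-induced system: for $H\leq G$, right cosets $H\backslash G$, and a section $s:H\backslash G\to G$ with $s(H)=e$, a t.d.s. $(X,H,\alpha)$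 induces on $X_H^G=\prod_{\theta\in H\backslash G}X$ the $G$-action $\alpha^{H\backslash G}_{g_0}(f)(Hg)=\alpha_{s(Hg)g_0s(Hgg_0)^{-1}}(f(Hgg_0))$ (independent of $s$ up to conjugacy). Here use the section $s(\mathbb{Z}(0,0))=(0,0)$, $s(\mathbb{Z}(0,x))=(0,x)$; then $(X_1)_{\mathbb{Z}}^G=X_1\times X_1$, the element $(n,0)$ acts by $(u,v)\mapsto(T^nu,T^{-n}v)$ and $(n,x)$ acts by $(u,v)\mapsto(T^nv,T^{-n}u)$. Construction of $(X_1,\mathbb{Z},T)$. Let $A=\{a_i:i\in\mathbb{Z}\}\cup\{a_\infty\}$ be the one-point compactification of $\mathbb{Z}$ embedded in the unit circle of $\mathbb{R}^2$ (distinct points, $a_i\to a_\infty$ as $|i|\to\infty$), and $T_1:A\to A$, $T_1(a_i)=a_{i+1}$ for $i\in\mathbb{Z}$, $T_1(a_\infty)=a_\infty$. For each $k\in\mathbb{N}$ choose integers $n_0^k,\dots,n_k^k$ with $n_0^k=0$, $n_1^1=9$, $n_{q+1}^k>100\,n_q^k$ for $1\le q\le k-1$, and $n_1^{k+1}>100\,n_k^k$. Choose subsets of $\mathbb{R}^2$ such that: (1) $U^k(a_i)$ is a closed neighborhood of $a_i$ for $i\in\mathbb{Z}\cup\{\infty\}$; (2) $U^k(a_i)\cap U^k(a_j)=\emptyset$ for distinct $i,j\in\mathbb{Z}$, $U^k(a_i)\cap U^k(a_\infty)=\emptyset$ for $|i|\le n_k^k$, and $U^k(a_i)\subseteq U^k(a_\infty)$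 for $i\in\mathbb{Z}$, $|i|>n_k^k$; (3) $U^{k+1}(a_i)\subseteq U^k(a_i)$ for $i\in\mathbb{Z}\cup\{\infty\}$; (4) $\operatorname{diam}U^k(a_i)\le 1/k$ for $i\in\mathbb{Z}\cup\{\infty\}$. Let $F(k)=\{0,1\}^{\{0,\dots,k\}}$. For $s\in F(k)$ and $q=1,\dots,k$ choose $j_{s,q}^k\in\mathbb{N}$ with $\left|\frac{n_q^k-n_{q-1}^k}{2}-j_{s,q}^k\right|\le\frac k2$ and put $p_{s,q}^k=n_q^k-n_{q-1}^k-j_{s,q}^k-s(q)$. For each $s\in F(k)$ choose distinct points $x_{s,i}\in\mathbb{R}^2$ ($i\in\mathbb{Z}$) such that for $q=1,\dots,k$: $x_{s,n_{q-1}^k+i}\in U^k(a_{s(q-1)+i})$ for $0\le i\le j_{s,q}^k-1$, and $x_{s,n_{q-1}^k+j_{s,q}^k+i}\in U^k(a_{-p_{s,q}^k+i})$ for $0\le i\le n_q^k-n_{q-1}^k-j_{s,q}^k$; and for $r\ge1$: $x_{s,n_k^k+r}\in U^{k+r}(a_{s(k)+r})$ and $x_{s,-r}\in U^{k+r}(a_{s(0)-r})$. Let $X_s=\{x_{s,i}:i\in\mathbb{Z}\}\cup\{a_\infty\}$; the points are chosen so that $X_s\cap A=\{a_\infty\}$ and $X_{s_1}\cap X_{s_2}=\{a_\infty\}$ for distinct $s_1,s_2\in\bigcup_kF(k)$. Let $X_1=\overline{\bigcup_{k=1}^\infty\bigcup_{s\in F(k)}X_s}$, which equals $A\cup\bigcup_{k}\bigcup_{s\in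 F(k)}X_s$, and define $T:X_1\to X_1$ by $T|_A=T_1$ and $T(x_{s,j})=x_{s,j+1}$; $T$ is a homeomorphism. *)

theory Defs
  imports "HOL-Analysis.Analysis" "HOL-Algebra.Elementary_Groups"
begin

subsection \<open>Maximal pattern entropy\<close>

definition open_cover :: "'x topology \<Rightarrow> 'x set set \<Rightarrow> bool" where
  "open_cover X \<U> \<longleftrightarrow> (\<forall>V\<in>\<U>. openin X V) \<and> \<Union>\<U> = topspace X"

definition min_subcover_card :: "'x topology \<Rightarrow> 'x set set \<Rightarrow> nat" where
  "min_subcover_card X \<U> =
     (LEAST m. \<exists>\<V>\<subseteq>\<U>. finite \<V> \<and> card \<V> = m \<and> topspace X \<subseteq> \<Union>\<V>)"

definition cover_join :: "'i set \<Rightarrow> ('i \<Rightarrow> 'x set set) \<Rightarrow> 'x set set" where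
  "cover_join I \<U> = {\<Inter>i\<in>I. V i | V. \<forall>i\<in>I. V i \<in> \<U> i}"

definition max_pattern_count ::
  "'x topology \<Rightarrow> ('g, 'm) monoid_scheme \<Rightarrow> ('g \<Rightarrow> 'x \<Rightarrow> 'x) \<Rightarrow> 'x set set \<Rightarrow> nat \<Rightarrow> nat" where
  "max_pattern_count X G \<alpha> \<U> n =
     Max {min_subcover_card X (cover_join {1..n} (\<lambda>i. (\<lambda>V. \<alpha> (inv\<^bsub>G\<^esub> (g i)) ` V) ` \<U>)) | g.
            g \<in> {1..n} \<rightarrow>\<^sub>E carrier G}"

definition cover_pattern_entropy ::
  "'x topology \<Rightarrow> ('g, 'm) monoid_scheme \<Rightarrow> ('g \<Rightarrow> 'x \<Rightarrow> 'x) \<Rightarrow> 'x set set \<Rightarrow> real" where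
  "cover_pattern_entropy X G \<alpha> \<U> = lim (\<lambda>n. ln (real (max_pattern_count X G \<alpha> \<U> n)) / real n)"

definition max_pattern_entropy ::
  "'x topology \<Rightarrow> ('g, 'm) monoid_scheme \<Rightarrow> ('g \<Rightarrow> 'x \<Rightarrow> 'x) \<Rightarrow> ereal" where
  "max_pattern_entropy X G \<alpha> = (SUP \<U>\<in>{\<U>. open_cover X \<U>}. ereal (cover_pattern_entropy X G \<alpha> \<U>))"


subsection \<open>Co-induced systems\<close>

definition coind_space ::
  "('g, 'm) monoid_scheme \<Rightarrow> 'g set \<Rightarrow> 'x topology \<Rightarrow> ('g set \<Rightarrow> 'x) topology" where
  "coind_space G H X = product_topology (\<lambda>_. X) (rcosets\<^bsub>G\<^esub> H)"

text \<open>For the coset \<open>\<theta> = Hg\<close>, the coset \<open>Hgg\<^sub>0\<close> is \<open>\<theta> #> g\<^sub>0\<close>.\<close>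

definition coind_action ::
  "('g, 'm) monoid_scheme \<Rightarrow> 'g set \<Rightarrow> ('g set \<Rightarrow> 'g) \<Rightarrow> ('g \<Rightarrow> 'x \<Rightarrow> 'x)
     \<Rightarrow> 'g \<Rightarrow> ('g set \<Rightarrow> 'x) \<Rightarrow> ('g set \<Rightarrow> 'x)" where
  "coind_action G H s \<alpha> g\<^sub>0 f =
     (\<lambda>\<theta>\<in>rcosets\<^bsub>G\<^esub> H.
        \<alpha> (s \<theta> \<otimes>\<^bsub>G\<^esub> g\<^sub>0 \<otimes>\<^bsub>G\<^esub> inv\<^bsub>G\<^esub> (s (\<theta> #>\<^bsub>G\<^esub> g\<^sub>0))) (f (\<theta> #>\<^bsub>G\<^esub> g\<^sub>0)))"


subsection \<open>The group and its index-two subgroup\<close>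

definition semidirect_product ::
  "('a, 'm) monoid_scheme \<Rightarrow> ('b, 'n) monoid_scheme \<Rightarrow> ('b \<Rightarrow> 'a \<Rightarrow> 'a) \<Rightarrow> ('a \<times> 'b) monoid" where
  "semidirect_product N K \<psi> =
     \<lparr>carrier = carrier N \<times> carrier K,
      monoid.mult = (\<lambda>(n, k) (n', k'). (n \<otimes>\<^bsub>N\<^esub> \<psi> k n', k \<otimes>\<^bsub>K\<^esub> k')),
      one = (\<one>\<^bsub>N\<^esub>, \<one>\<^bsub>K\<^esub>)\<rparr>"

text \<open>The generator \<open>x\<close> of the group of order two is \<open>1\<close> in \<^term>\<open>integer_mod_group 2\<close>,
  whose carrier is \<open>{0, 1}\<close>.\<close>

definition dih_group :: "(int \<times> int) monoid" where
  "dih_group = semidirect_product integer_group (integer_mod_group 2) (\<lambda>k m. if k = 0 then m else - m)"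

definition dih_Z :: "(int \<times> int) set" where
  "dih_Z = UNIV \<times> {0}"

definition dih_section :: "(int \<times> int) set \<Rightarrow> int \<times> int" where
  "dih_section \<theta> = (if \<theta> = dih_Z then (0, 0) else (0, 1))"

definition int_iterate :: "'x set \<Rightarrow> ('x \<Rightarrow> 'x) \<Rightarrow> int \<Rightarrow> 'x \<Rightarrow> 'x" where
  "int_iterate X T m = (if m \<ge> 0 then T ^^ nat m else inv_into X T ^^ nat (- m))"

text \<open>The action of \<open>\<int>\<close> generated by \<open>T\<close>, with \<open>m\<close> identified with \<open>(m, 0)\<close>.\<close>

definition dih_Z_action :: "'x set \<Rightarrow> ('x \<Rightarrow> 'x) \<Rightarrow> int \<times> int \<Rightarrow> 'x \<Rightarrow> 'x" where
  "dih_Z_action X T h = int_iterate X T (fst h)"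


subsection \<open>The construction of the system\<close>

definition words :: "nat \<Rightarrow> (nat \<Rightarrow> int) set" where
  "words k = {0..k} \<rightarrow>\<^sub>E {0, 1}"

text \<open>Everything indexed by a word carries the index \<open>k\<close> explicitly: extensional functions take the
  value \<^term>\<open>undefined\<close> outside their domain, so the sets \<^term>\<open>words k\<close> for different \<open>k\<close> are
  not provably disjoint.\<close>

definition X_word :: "'x \<Rightarrow> (nat \<Rightarrow> (nat \<Rightarrow> int) \<Rightarrow> int \<Rightarrow> 'x) \<Rightarrow> nat \<Rightarrow> (nat \<Rightarrow> int) \<Rightarrow> 'x set" where
  "X_word a_inf x k s = range (x k s) \<union> {a_inf}"

definition X1 :: "'x::topological_space \<Rightarrow> (nat \<Rightarrow> (nat \<Rightarrow> int) \<Rightarrow> int \<Rightarrow> 'x) \<Rightarrow> 'x set" where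
  "X1 a_inf x = closure (\<Union>k\<in>{1..}. \<Union>s\<in>words k. X_word a_inf x k s)"

text \<open>Here \<open>n k q\<close>, \<open>U k i\<close>, \<open>U_inf k\<close>, \<open>j k s q\<close>, \<open>x k s i\<close> stand for \<open>n_q^k\<close>, \<open>U^k(a_i)\<close>,
  \<open>U^k(a_\<infinity>)\<close>, \<open>j_{s,q}^k\<close>, \<open>x_{s,i}\<close> (with \<open>s\<close> a word in \<^term>\<open>words k\<close>). The numbers
  \<open>p_{s,q}^k\<close> are determined by the other data. Boundedness accompanies every bound on \<^const>\<open>diameter\<close>,
  which is unspecified on unbounded sets.\<close>

locale X1_construction =
  fixes a :: "int \<Rightarrow> real^2" and a_inf :: "real^2"
    and n :: "nat \<Rightarrow> nat \<Rightarrow> int"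
    and U :: "nat \<Rightarrow> int \<Rightarrow> (real^2) set" and U_inf :: "nat \<Rightarrow> (real^2) set"
    and j :: "nat \<Rightarrow> (nat \<Rightarrow> int) \<Rightarrow> nat \<Rightarrow> int"
    and p :: "nat \<Rightarrow> (nat \<Rightarrow> int) \<Rightarrow> nat \<Rightarrow> int"
    and x :: "nat \<Rightarrow> (nat \<Rightarrow> int) \<Rightarrow> int \<Rightarrow> real^2"
    and T :: "real^2 \<Rightarrow> real^2"
  assumes a_circle: "range a \<subseteq> sphere 0 1" "a_inf \<in> sphere 0 1"
    and a_distinct: "inj a" "a_inf \<notin> range a"
    and a_at_top: "(a \<longlongrightarrow> a_inf) at_top"
    and a_at_bot: "(a \<longlongrightarrow> a_inf) at_bot"
    and n_0: "\<And>k. k \<ge> 1 \<Longrightarrow> n k 0 = 0"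
    and n_1_1: "n 1 1 = 9"
    and n_step: "\<And>k q. k \<ge> 1 \<Longrightarrow> 1 \<le> q \<Longrightarrow> q < k \<Longrightarrow> n k (q + 1) > 100 * n k q"
    and n_next: "\<And>k. k \<ge> 1 \<Longrightarrow> n (k + 1) 1 > 100 * n k k"
    and U_nhd: "\<And>k i. k \<ge> 1 \<Longrightarrow> closed (U k i) \<and> a i \<in> interior (U k i)"
    and U_inf_nhd: "\<And>k. k \<ge> 1 \<Longrightarrow> closed (U_inf k) \<and> a_inf \<in> interior (U_inf k)"
    and U_disjoint: "\<And>k i i'. k \<ge> 1 \<Longrightarrow> i \<noteq> i' \<Longrightarrow> U k i \<inter> U k i' = {}"
    and U_inf_disjoint: "\<And>k i. k \<ge> 1 \<Longrightarrow> \<bar>i\<bar> \<le> n k k \<Longrightarrow> U k i \<inter> U_inf k = {}"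
    and U_inf_contains: "\<And>k i. k \<ge> 1 \<Longrightarrow> \<bar>i\<bar> > n k k \<Longrightarrow> U k i \<subseteq> U_inf k"
    and U_decreasing: "\<And>k i. k \<ge> 1 \<Longrightarrow> U (k + 1) i \<subseteq> U k i"
    and U_inf_decreasing: "\<And>k. k \<ge> 1 \<Longrightarrow> U_inf (k + 1) \<subseteq> U_inf k"
    and U_diameter: "\<And>k i. k \<ge> 1 \<Longrightarrow> bounded (U k i) \<and> diameter (U k i) \<le> 1 / real k"
    and U_inf_diameter: "\<And>k. k \<ge> 1 \<Longrightarrow> bounded (U_inf k) \<and> diameter (U_inf k) \<le> 1 / real k"
    and j_pos: "\<And>k s q. k \<ge> 1 \<Longrightarrow> s \<in> words k \<Longrightarrow> q \<in> {1..k} \<Longrightarrow> j k s q \<ge> 1"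
    and j_near: "\<And>k s q. k \<ge> 1 \<Longrightarrow> s \<in> words k \<Longrightarrow> q \<in> {1..k} \<Longrightarrow>
          \<bar>real_of_int (n k q - n k (q - 1)) / 2 - real_of_int (j k s q)\<bar> \<le> real k / 2"
    and p_eq: "\<And>k s q. k \<ge> 1 \<Longrightarrow> s \<in> words k \<Longrightarrow> q \<in> {1..k} \<Longrightarrow>
          p k s q = n k q - n k (q - 1) - j k s q - s q"
    and x_distinct: "\<And>k s. k \<ge> 1 \<Longrightarrow> s \<in> words k \<Longrightarrow> inj (x k s)"
    and x_first: "\<And>k s q i. k \<ge> 1 \<Longrightarrow> s \<in> words k \<Longrightarrow> q \<in> {1..k} \<Longrightarrow>
          0 \<le> i \<Longrightarrow> i \<le> j k s q - 1 \<Longrightarrow>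
          x k s (n k (q - 1) + i) \<in> U k (s (q - 1) + i)"
    and x_second: "\<And>k s q i. k \<ge> 1 \<Longrightarrow> s \<in> words k \<Longrightarrow> q \<in> {1..k} \<Longrightarrow>
          0 \<le> i \<Longrightarrow> i \<le> n k q - n k (q - 1) - j k s q \<Longrightarrow>
          x k s (n k (q - 1) + j k s q + i) \<in> U k (- p k s q + i)"
    and x_right: "\<And>k s r. k \<ge> 1 \<Longrightarrow> s \<in> words k \<Longrightarrow> r \<ge> 1 \<Longrightarrow>
          x k s (n k k + int r) \<in> U (k + r) (s k + int r)"
    and x_left: "\<And>k s r. k \<ge> 1 \<Longrightarrow> s \<in> words k \<Longrightarrow> r \<ge> 1 \<Longrightarrow>
          x k s (- int r) \<in> U (k + r) (s 0 - int r)"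
    and X_word_A: "\<And>k s. k \<ge> 1 \<Longrightarrow> s \<in> words k \<Longrightarrow>
          X_word a_inf x k s \<inter> (range a \<union> {a_inf}) = {a_inf}"
    and X_word_disjoint: "\<And>k s k' s'. k \<ge> 1 \<Longrightarrow> s \<in> words k \<Longrightarrow> k' \<ge> 1 \<Longrightarrow> s' \<in> words k' \<Longrightarrow>
          (k, s) \<noteq> (k', s') \<Longrightarrow> X_word a_inf x k s \<inter> X_word a_inf x k' s' = {a_inf}"
    and T_a: "\<And>i. T (a i) = a (i + 1)"
    and T_a_inf: "T a_inf = a_inf"
    and T_x: "\<And>k s i. k \<ge> 1 \<Longrightarrow> s \<in> words k \<Longrightarrow> T (x k s i) = x k s (i + 1)"

end

theory Submission
  imports Defs "HOL-Real_Asymp.Real_Asymp"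
begin

text \<open>Replace a point of \<open>X\<^sub>1\<close> by its label at scale \<open>K\<close>: the centre of the cell \<open>U^K(a_l)\<close> or
  \<open>U^K(a_\<infinity>)\<close> containing it, or the point itself for the finitely many points outside all cells. The
  element \<open>(m, 0)\<close> looks at \<open>T^m u\<close> and \<open>T^{-m} v\<close>, the element \<open>(m, x)\<close> at \<open>T^m v\<close> and \<open>T^{-m} u\<close>, so
  \<open>N\<close> group elements only see the labels of \<open>u\<close> along some \<open>E \<subseteq> \<int>\<close> with \<open>|E| \<le> N\<close> and those of \<open>v\<close>
  along \<open>-E\<close>.

  The orbit of \<open>x_{s,i}\<close>, with \<open>s\<close> of length \<open>k > K\<close>, carries the label \<open>a_\<infinity>\<close> except in bounded windows
  around the times \<open>n_q^k\<close>, where it looks like the orbit of \<open>a_{s(q)}\<close>. Hence \<open>E\<close> sees \<open>2^h\<close> patterns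
  from a given \<open>(k, i)\<close>, where \<open>h\<close> is the number of windows met by \<open>E + i\<close>; and since two times in
  different windows determine \<open>k\<close>, only \<open>O(N^2)\<close> pairs \<open>(k, i)\<close> meet more than one window. Picking one time
  in each window gives a subset of \<open>E\<close> with \<open>h\<close> elements whose gaps increase, because the \<open>n_q^k\<close> are
  lacunary. The corresponding subset for \<open>-E\<close> has, after reflection, decreasing gaps, so the two meet in at
  most two elements. Together they have at most \<open>N + 2\<close> elements, and the number of patterns is
  \<open>O(N^4 2^N)\<close>. Conversely, the points \<open>x_{s,0}\<close> realise all \<open>0\<close>-\<open>1\<close> patterns at the times \<open>n_q^k\<close>.\<close>

section \<open>Maximal pattern entropy of a cover\<close>

lemma subadditive_mult_le:
  fixes f :: "nat \<Rightarrow> real"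
  assumes sub: "\<And>m k. f (m + k) \<le> f m + f k"
  shows "f (q * m + r) \<le> real q * f m + f r"
proof (induction q)
  case (Suc q)
  have "f (Suc q * m + r) \<le> f m + f (q * m + r)"
    using sub[of m "q * m + r"] by (simp add: algebra_simps)
  with Suc show ?case by (simp add: algebra_simps)
qed simp

text \<open>Fekete's lemma: the averages tend to their infimum, which nonnegativity keeps finite.
  Given \<open>m\<close> whose average is near the infimum, \<open>k\<close> is split into copies of
  \<open>m\<close> and a remainder.\<close>

lemma subadditive_convergent_average:
  fixes f :: "nat \<Rightarrow> real"
  assumes sub: "\<And>m k. f (m + k) \<le> f m + f k" and nonneg: "\<And>k. f k \<ge> 0"
  shows "convergent (\<lambda>k. f k / real k)"
proof -
  define L where "L = (INF k\<in>{1..}. f k / real k)"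
  have bdd: "bdd_below ((\<lambda>k. f k / real k) ` {1..})"
    by (rule bdd_belowI[of _ 0]) (auto simp: nonneg)
  have lower: "L \<le> f k / real k" if "k \<ge> 1" for k
    unfolding L_def using that by (intro cINF_lower bdd) auto
  have "(\<lambda>k. f k / real k) \<longlonglongrightarrow> L"
  proof (rule LIMSEQ_I)
    fix \<epsilon> :: real assume \<epsilon>: "\<epsilon> > 0"
    have "\<exists>m\<in>{1..}. f m / real m < L + \<epsilon> / 2"
      using cINF_less_iff[OF _ bdd, of "L + \<epsilon> / 2"] \<epsilon> unfolding L_def by auto
    then obtain m where m: "m \<ge> 1" "f m / real m < L + \<epsilon> / 2" by auto
    \<comment> \<open>\<open>C\<close> bounds \<open>f\<close> on every remainder modulo
      \<open>m\<close>; its contribution vanishes after division by a large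
      \<open>k\<close>.\<close>
    define C where "C = (\<Sum>r<m. f r)"
    have C: "f r \<le> C" if "r < m" for r
      unfolding C_def using that by (intro member_le_sum) (auto simp: nonneg)
    obtain N where N: "real N > 2 * C / \<epsilon>" using reals_Archimedean2 by blast
    have "norm (f k / real k - L) < \<epsilon>" if k: "k \<ge> max N 1" for k
    proof -
      have "f k \<le> real (k div m) * f m + f (k mod m)"
        using subadditive_mult_le[of f "k div m" m "k mod m", OF sub] by simp
      also have "\<dots> \<le> real (k div m) * f m + C"
        using C[of "k mod m"] m by simp
      also have "real (k div m) * f m \<le> (real k / real m) * f m"
        by (intro mult_right_mono nonneg of_nat_div_le_of_nat)
      finally have "f k \<le> real k * (f m / real m) + C" by simp
      then have "f k / real k \<le> f m / real m + C / real k"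
        using k by (simp add: field_simps)
      moreover have "C / real k < \<epsilon> / 2"
      proof -
        have "2 * C / \<epsilon> < real k" using N k by (simp add: less_le_trans)
        then show ?thesis using k \<epsilon> by (simp add: field_simps)
      qed
      ultimately have "f k / real k - L < \<epsilon>" using m(2) by linarith
      then show ?thesis using lower[of k] k by (simp add: abs_if)
    qed
    then show "\<exists>N. \<forall>k\<ge>N. norm (f k / real k - L) < \<epsilon>" by blast
  qed
  then show ?thesis by (rule convergentI)
qed

section \<open>Joined covers of an abstract action and their subcovers\<close>

locale pattern_system =
  fixes X :: "'x topology" and G :: "('g, 'm) monoid_scheme" and \<alpha> :: "'g \<Rightarrow> 'x \<Rightarrow> 'x"
  assumes nonempty: "topspace X \<noteq> {}"
    and compact: "compact_space X"
    and carrier_nonempty: "carrier G \<noteq> {}"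
    and act_closed: "g \<in> carrier G \<Longrightarrow> f \<in> topspace X \<Longrightarrow> \<alpha> g f \<in> topspace X"
    and act_preimage: "g \<in> carrier G \<Longrightarrow> V \<subseteq> topspace X \<Longrightarrow> f \<in> topspace X \<Longrightarrow>
          f \<in> \<alpha> (inv\<^bsub>G\<^esub> g) ` V \<longleftrightarrow> \<alpha> g f \<in> V"
begin

definition pattern_cover :: "'x set set \<Rightarrow> nat \<Rightarrow> (nat \<Rightarrow> 'g) \<Rightarrow> 'x set set" where
  "pattern_cover \<U> k g = cover_join {1..k} (\<lambda>i. (\<lambda>V. \<alpha> (inv\<^bsub>G\<^esub> (g i)) ` V) ` \<U>)"

definition pattern_number :: "'x set set \<Rightarrow> nat \<Rightarrow> (nat \<Rightarrow> 'g) \<Rightarrow> nat" where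
  "pattern_number \<U> k g = min_subcover_card X (pattern_cover \<U> k g)"

lemma pattern_cover_cong:
  "(\<And>i. i \<in> {1..k} \<Longrightarrow> g i = g' i) \<Longrightarrow> pattern_cover \<U> k g = pattern_cover \<U> k g'"
  unfolding pattern_cover_def cover_join_def by (intro Collect_cong ex_cong1) auto

lemma open_coverD: "open_cover X \<U> \<Longrightarrow> V \<in> \<U> \<Longrightarrow> V \<subseteq> topspace X"
  unfolding open_cover_def by (auto dest: openin_subset)

text \<open>By \<open>act_preimage\<close> a translate by the inverse is a preimage, so a member of
  the joined cover prescribes, for each \<open>g i\<close>, a member of \<open>\<U>\<close> in which
  the image lies.\<close>

lemma pattern_coverE:
  assumes "W \<in> pattern_cover \<U> k g" "g \<in> {1..k} \<rightarrow> carrier G" "open_cover X \<U>"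
  obtains V where "\<And>i. i \<in> {1..k} \<Longrightarrow> V i \<in> \<U>"
    and "\<And>f i. f \<in> W \<Longrightarrow> f \<in> topspace X \<Longrightarrow> i \<in> {1..k} \<Longrightarrow> \<alpha> (g i) f \<in> V i"
proof -
  obtain V where V: "W = (\<Inter>i\<in>{1..k}. V i)"
      "\<forall>i\<in>{1..k}. V i \<in> (\<lambda>V. \<alpha> (inv\<^bsub>G\<^esub> (g i)) ` V) ` \<U>"
    using assms(1) unfolding pattern_cover_def cover_join_def by auto
  from V(2) have "\<forall>i\<in>{1..k}. \<exists>V'\<in>\<U>. V i = \<alpha> (inv\<^bsub>G\<^esub> (g i)) ` V'" by blast
  then obtain V' where V': "\<And>i. i \<in> {1..k} \<Longrightarrow> V' i \<in> \<U>"
      "\<And>i. i \<in> {1..k} \<Longrightarrow> V i = \<alpha> (inv\<^bsub>G\<^esub> (g i)) ` V' i" by metis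
  show ?thesis
  proof (rule that[of V'])
    fix f i assume f: "f \<in> W" "f \<in> topspace X" and i: "i \<in> {1..k}"
    have "g i \<in> carrier G" using assms(2) i by auto
    moreover have "f \<in> \<alpha> (inv\<^bsub>G\<^esub> (g i)) ` V' i" using f i V(1) V'(2)[OF i] by auto
    ultimately show "\<alpha> (g i) f \<in> V' i"
      using act_preimage[OF _ open_coverD[OF assms(3) V'(1)[OF i]] f(2)] by blast
  qed (use V' in auto)
qed

text \<open>Each name gives a single member of the joined cover, the intersection of the translates
  chosen for it, and this contains every point with that name. All upper bounds on pattern numbers
  go through such codings.\<close>

lemma subcover_by_names:
  assumes cov: "open_cover X \<U>" and g: "g \<in> {1..k} \<rightarrow> carrier G"
    and fin: "finite (name ` topspace X)"
    and names: "\<And>i f. i \<in> {1..k} \<Longrightarrow> f \<in> topspace X \<Longrightarrow>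
      \<exists>V\<in>\<U>. \<forall>f'\<in>topspace X. name f' = name f \<longrightarrow> \<alpha> (g i) f' \<in> V"
  shows "\<exists>\<V>\<subseteq>pattern_cover \<U> k g. finite \<V> \<and> card \<V> \<le> card (name ` topspace X) \<and>
    topspace X \<subseteq> \<Union>\<V>"
proof -
  have "\<forall>c\<in>name ` topspace X. \<forall>i\<in>{1..k}. \<exists>V\<in>\<U>. \<forall>f'\<in>topspace X. name f' = c \<longrightarrow> \<alpha> (g i) f' \<in> V"
    using names by blast
  then obtain V where V: "\<And>c i. c \<in> name ` topspace X \<Longrightarrow> i \<in> {1..k} \<Longrightarrow> V c i \<in> \<U>"
    "\<And>c i f'. c \<in> name ` topspace X \<Longrightarrow> i \<in> {1..k} \<Longrightarrow> f' \<in> topspace X \<Longrightarrow> name f' = c \<Longrightarrow>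
      \<alpha> (g i) f' \<in> V c i" by metis
  define W where "W c = (\<Inter>i\<in>{1..k}. \<alpha> (inv\<^bsub>G\<^esub> (g i)) ` V c i)" for c
  have "f \<in> W (name f)" if "f \<in> topspace X" for f
    unfolding W_def
  proof
    fix i assume i: "i \<in> {1..k}"
    have "V (name f) i \<subseteq> topspace X" using V(1) open_coverD[OF cov] i that by blast
    then show "f \<in> \<alpha> (inv\<^bsub>G\<^esub> (g i)) ` V (name f) i"
      using act_preimage[of "g i" "V (name f) i" f] g i that V(2)[of "name f" i f] by blast
  qed
  moreover have "W c \<in> pattern_cover \<U> k g" if "c \<in> name ` topspace X" for c
    unfolding pattern_cover_def cover_join_def W_def using V(1)[OF that]
    by (intro CollectI exI[of _ "\<lambda>i. \<alpha> (inv\<^bsub>G\<^esub> (g i)) ` V c i"]) auto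
  ultimately show ?thesis
    using fin by (intro exI[of _ "W ` name ` topspace X"]) (auto intro: card_image_le)
qed

lemma pattern_number_le_names:
  assumes "open_cover X \<U>" "g \<in> {1..k} \<rightarrow> carrier G" "finite (name ` topspace X)"
    and "\<And>i f. i \<in> {1..k} \<Longrightarrow> f \<in> topspace X \<Longrightarrow>
      \<exists>V\<in>\<U>. \<forall>f'\<in>topspace X. name f' = name f \<longrightarrow> \<alpha> (g i) f' \<in> V"
  shows "pattern_number \<U> k g \<le> card (name ` topspace X)"
proof -
  obtain \<V> where \<V>: "\<V> \<subseteq> pattern_cover \<U> k g" "finite \<V>" "card \<V> \<le> card (name ` topspace X)"
    "topspace X \<subseteq> \<Union>\<V>" using subcover_by_names[of \<U> g k name] assms by blast
  have "pattern_number \<U> k g \<le> card \<V>"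
    unfolding pattern_number_def min_subcover_card_def by (rule Least_le) (use \<V> in auto)
  with \<V> show ?thesis by simp
qed

lemma finite_subcover_choice:
  assumes "open_cover X \<U>"
  obtains \<F> c where "finite \<F>" "\<F> \<subseteq> \<U>" "\<And>f. f \<in> topspace X \<Longrightarrow> c f \<in> \<F> \<and> f \<in> c f"
proof -
  have "\<exists>\<F>. finite \<F> \<and> \<F> \<subseteq> \<U> \<and> topspace X \<subseteq> \<Union>\<F>"
    using compact assms unfolding open_cover_def by (intro compactinD) (auto simp: compact_space_def)
  then obtain \<F> where \<F>: "finite \<F>" "\<F> \<subseteq> \<U>" "topspace X \<subseteq> \<Union>\<F>" by blast
  then have "\<forall>f\<in>topspace X. \<exists>V\<in>\<F>. f \<in> V" by blast
  then obtain c where "\<And>f. f \<in> topspace X \<Longrightarrow> c f \<in> \<F> \<and> f \<in> c f" by metis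
  with \<F> that show ?thesis by blast
qed

text \<open>The name is the sequence of members of one fixed finite subcover that the point visits.
  This subcover depends on neither \<open>k\<close> nor \<open>g\<close>, so the bound is uniform in
  \<open>g\<close>, and the maximum over possibly infinitely many tuples is one of finitely many
  numbers.\<close>

lemma finite_itineraries:
  assumes "open_cover X \<U>"
  obtains B where "\<And>k g. g \<in> {1..k} \<rightarrow> carrier G \<Longrightarrow>
    \<exists>name :: 'x \<Rightarrow> nat \<Rightarrow> 'x set. finite (name ` topspace X) \<and> card (name ` topspace X) \<le> B ^ k \<and>
    (\<forall>i\<in>{1..k}. \<forall>f\<in>topspace X. \<exists>V\<in>\<U>. \<forall>f'\<in>topspace X. name f' = name f \<longrightarrow> \<alpha> (g i) f' \<in> V)"
proof -
  obtain \<F> c where \<F>: "finite \<F>" "\<F> \<subseteq> \<U>" and c: "\<And>f. f \<in> topspace X \<Longrightarrow> c f \<in> \<F> \<and> f \<in> c f"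
    using finite_subcover_choice[OF assms] by metis
  have "\<exists>name :: 'x \<Rightarrow> nat \<Rightarrow> 'x set. finite (name ` topspace X) \<and> card (name ` topspace X) \<le> card \<F> ^ k \<and>
    (\<forall>i\<in>{1..k}. \<forall>f\<in>topspace X. \<exists>V\<in>\<U>. \<forall>f'\<in>topspace X. name f' = name f \<longrightarrow> \<alpha> (g i) f' \<in> V)"
    if g: "g \<in> {1..k} \<rightarrow> carrier G" for k g
  proof -
    define name where "name f = (\<lambda>i\<in>{1..k}. c (\<alpha> (g i) f))" for f
    have sub: "name ` topspace X \<subseteq> {1..k} \<rightarrow>\<^sub>E \<F>"
      unfolding name_def using c act_closed g by (auto simp: Pi_iff)
    have fin: "finite ({1..k} \<rightarrow>\<^sub>E \<F>)" using \<F> by (intro finite_PiE) auto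
    have "card (name ` topspace X) \<le> card \<F> ^ k"
      using card_mono[OF fin sub] by (simp add: card_PiE)
    moreover have "\<exists>V\<in>\<U>. \<forall>f'\<in>topspace X. name f' = name f \<longrightarrow> \<alpha> (g i) f' \<in> V"
      if "i \<in> {1..k}" "f \<in> topspace X" for i f
    proof
      have gi: "g i \<in> carrier G" using g that by auto
      show "c (\<alpha> (g i) f) \<in> \<U>" using c act_closed[OF gi] that \<F> by blast
      show "\<forall>f'\<in>topspace X. name f' = name f \<longrightarrow> \<alpha> (g i) f' \<in> c (\<alpha> (g i) f)"
      proof (intro ballI impI)
        fix f' assume f': "f' \<in> topspace X" "name f' = name f"
        then have "name f' i = name f i" by simp
        then have "c (\<alpha> (g i) f') = c (\<alpha> (g i) f)"
          using that(1) by (simp add: name_def)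
        then show "\<alpha> (g i) f' \<in> c (\<alpha> (g i) f)" using c act_closed[OF gi f'(1)] by metis
      qed
    qed
    ultimately show ?thesis using finite_subset[OF sub fin] by blast
  qed
  with that show ?thesis by blast
qed

text \<open>Compactness provides some finite subcover, so the \<open>LEAST\<close> in
  \<open>min_subcover_card\<close> is attained.\<close>

lemma minimal_subcover:
  assumes "open_cover X \<U>" "g \<in> {1..k} \<rightarrow> carrier G"
  shows "\<exists>\<V>\<subseteq>pattern_cover \<U> k g. finite \<V> \<and> card \<V> = pattern_number \<U> k g \<and> topspace X \<subseteq> \<Union>\<V>"
proof -
  obtain name :: "'x \<Rightarrow> nat \<Rightarrow> 'x set" where name: "finite (name ` topspace X)"
    "\<forall>i\<in>{1..k}. \<forall>f\<in>topspace X. \<exists>V\<in>\<U>. \<forall>f'\<in>topspace X. name f' = name f \<longrightarrow> \<alpha> (g i) f' \<in> V"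
    using finite_itineraries[OF assms(1)] assms(2) by metis
  have "\<exists>\<V>\<subseteq>pattern_cover \<U> k g. finite \<V> \<and> card \<V> \<le> card (name ` topspace X) \<and> topspace X \<subseteq> \<Union>\<V>"
    using name by (intro subcover_by_names assms) auto
  then have "\<exists>m. \<exists>\<V>\<subseteq>pattern_cover \<U> k g. finite \<V> \<and> card \<V> = m \<and> topspace X \<subseteq> \<Union>\<V>" by blast
  from LeastI_ex[OF this] show ?thesis unfolding pattern_number_def min_subcover_card_def .
qed

text \<open>A point is named by one member of a minimal subcover for the first \<open>m\<close>
  times and one for the last \<open>k\<close> times; the pair controls all \<open>m + k\<close>
  images.\<close>

lemma pattern_number_add_le:
  assumes cov: "open_cover X \<U>" and g: "g \<in> {1..m + k} \<rightarrow> carrier G"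
  shows "pattern_number \<U> (m + k) g \<le> pattern_number \<U> m g * pattern_number \<U> k (\<lambda>i. g (m + i))"
proof -
  have g1: "g \<in> {1..m} \<rightarrow> carrier G" and g2: "(\<lambda>i. g (m + i)) \<in> {1..k} \<rightarrow> carrier G" using g by auto
  obtain \<V>1 where V1: "\<V>1 \<subseteq> pattern_cover \<U> m g" "finite \<V>1" "card \<V>1 = pattern_number \<U> m g"
    "topspace X \<subseteq> \<Union>\<V>1" using minimal_subcover[OF cov g1] by blast
  obtain \<V>2 where V2: "\<V>2 \<subseteq> pattern_cover \<U> k (\<lambda>i. g (m + i))" "finite \<V>2"
    "card \<V>2 = pattern_number \<U> k (\<lambda>i. g (m + i))"
    "topspace X \<subseteq> \<Union>\<V>2" using minimal_subcover[OF cov g2] by blast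
  have "\<forall>f\<in>topspace X. \<exists>W\<in>\<V>1. f \<in> W" "\<forall>f\<in>topspace X. \<exists>W\<in>\<V>2. f \<in> W" using V1 V2 by blast+
  then obtain c1 c2 where c: "\<And>f. f \<in> topspace X \<Longrightarrow> c1 f \<in> \<V>1 \<and> f \<in> c1 f"
    "\<And>f. f \<in> topspace X \<Longrightarrow> c2 f \<in> \<V>2 \<and> f \<in> c2 f" by metis
  define name where "name f = (c1 f, c2 f)" for f
  have sub: "name ` topspace X \<subseteq> \<V>1 \<times> \<V>2" using c by (auto simp: name_def)
  have "pattern_number \<U> (m + k) g \<le> card (name ` topspace X)"
  proof (rule pattern_number_le_names[OF cov g])
    show "finite (name ` topspace X)" using finite_subset[OF sub] V1 V2 by auto
    fix i f assume i: "i \<in> {1..m + k}" and f: "f \<in> topspace X"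
    obtain A where A: "\<And>i. i \<in> {1..m} \<Longrightarrow> A i \<in> \<U>"
      "\<And>f' i. f' \<in> c1 f \<Longrightarrow> f' \<in> topspace X \<Longrightarrow> i \<in> {1..m} \<Longrightarrow> \<alpha> (g i) f' \<in> A i"
      using pattern_coverE[OF _ g1 cov, of "c1 f"] c(1)[OF f] V1(1) by blast
    obtain B where B: "\<And>i. i \<in> {1..k} \<Longrightarrow> B i \<in> \<U>"
      "\<And>f' i. f' \<in> c2 f \<Longrightarrow> f' \<in> topspace X \<Longrightarrow> i \<in> {1..k} \<Longrightarrow> \<alpha> (g (m + i)) f' \<in> B i"
      using pattern_coverE[OF _ g2 cov, of "c2 f"] c(2)[OF f] V2(1) by blast
    show "\<exists>V\<in>\<U>. \<forall>f'\<in>topspace X. name f' = name f \<longrightarrow> \<alpha> (g i) f' \<in> V"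
    proof (cases "i \<le> m")
      case True
      then have "i \<in> {1..m}" using i by auto
      then have im: "A i \<in> \<U>" "\<And>f'. f' \<in> c1 f \<Longrightarrow> f' \<in> topspace X \<Longrightarrow> \<alpha> (g i) f' \<in> A i"
        using A by auto
      have "\<alpha> (g i) f' \<in> A i" if "f' \<in> topspace X" "name f' = name f" for f'
        using that im(2)[of f'] c(1)[of f'] unfolding name_def by simp
      with im(1) show ?thesis by blast
    next
      case False
      then have "i - m \<in> {1..k}" "m + (i - m) = i" using i by auto
      then have im: "B (i - m) \<in> \<U>"
        "\<And>f'. f' \<in> c2 f \<Longrightarrow> f' \<in> topspace X \<Longrightarrow> \<alpha> (g i) f' \<in> B (i - m)"
        using B(1)[of "i - m"] B(2)[of _ "i - m"] by auto
      have "\<alpha> (g i) f' \<in> B (i - m)" if "f' \<in> topspace X" "name f' = name f" for f'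
        using that im(2)[of f'] c(2)[of f'] unfolding name_def by simp
      with im(1) show ?thesis by blast
    qed
  qed
  also have "\<dots> \<le> card (\<V>1 \<times> \<V>2)" using sub V1 V2 by (intro card_mono) auto
  also have "\<dots> = pattern_number \<U> m g * pattern_number \<U> k (\<lambda>i. g (m + i))"
    using V1 V2 by (simp add: card_cartesian_product)
  finally show ?thesis .
qed

text \<open>Pigeonhole: a choice of a member of the subcover around each point of \<open>P\<close>
  is injective. Lower bounds come from this.\<close>

lemma pattern_number_ge_separated:
  assumes cov: "open_cover X \<U>" and g: "g \<in> {1..k} \<rightarrow> carrier G"
    and P: "P \<subseteq> topspace X"
    and sep: "\<And>W f f'. W \<in> pattern_cover \<U> k g \<Longrightarrow> f \<in> P \<inter> W \<Longrightarrow> f' \<in> P \<inter> W \<Longrightarrow> f = f'"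
  shows "card P \<le> pattern_number \<U> k g"
proof -
  obtain \<V> where V: "\<V> \<subseteq> pattern_cover \<U> k g" "finite \<V>" "card \<V> = pattern_number \<U> k g"
    "topspace X \<subseteq> \<Union>\<V>" using minimal_subcover[OF cov g] by blast
  have "\<forall>f\<in>P. \<exists>W\<in>\<V>. f \<in> W" using V P by blast
  then obtain c where c: "\<And>f. f \<in> P \<Longrightarrow> c f \<in> \<V> \<and> f \<in> c f" by metis
  have "inj_on c P"
  proof (rule inj_onI)
    fix f f' assume "f \<in> P" "f' \<in> P" "c f = c f'"
    then show "f = f'" using c[of f] c[of f'] V(1) by (intro sep[of "c f"]) auto
  qed
  moreover have "c ` P \<subseteq> \<V>" using c by auto
  ultimately show ?thesis using V card_inj_on_le by metis
qed

lemma pattern_number_pos: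
  assumes "open_cover X \<U>" "g \<in> {1..k} \<rightarrow> carrier G"
  shows "pattern_number \<U> k g \<ge> 1"
proof -
  obtain f where "f \<in> topspace X" using nonempty by blast
  then show ?thesis using pattern_number_ge_separated[OF assms, of "{f}"] by auto
qed

lemma max_pattern_count_eq:
  "max_pattern_count X G \<alpha> \<U> k = Max (pattern_number \<U> k ` ({1..k} \<rightarrow>\<^sub>E carrier G))"
  unfolding max_pattern_count_def pattern_number_def pattern_cover_def
  by (simp add: Setcompr_eq_image)

lemma finite_pattern_numbers:
  assumes "open_cover X \<U>"
  shows "finite (pattern_number \<U> k ` ({1..k} \<rightarrow>\<^sub>E carrier G))"
proof -
  obtain B where B: "\<And>k g. g \<in> {1..k} \<rightarrow> carrier G \<Longrightarrow>
    \<exists>name :: 'x \<Rightarrow> nat \<Rightarrow> 'x set. finite (name ` topspace X) \<and> card (name ` topspace X) \<le> B ^ k \<and>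
    (\<forall>i\<in>{1..k}. \<forall>f\<in>topspace X. \<exists>V\<in>\<U>. \<forall>f'\<in>topspace X. name f' = name f \<longrightarrow> \<alpha> (g i) f' \<in> V)"
    using finite_itineraries[OF assms(1)] by blast
  have "pattern_number \<U> k g \<le> B ^ k" if "g \<in> {1..k} \<rightarrow>\<^sub>E carrier G" for g
  proof -
    have g: "g \<in> {1..k} \<rightarrow> carrier G" using that by auto
    obtain name :: "'x \<Rightarrow> nat \<Rightarrow> 'x set" where name: "finite (name ` topspace X)"
      "card (name ` topspace X) \<le> B ^ k"
      "\<forall>i\<in>{1..k}. \<forall>f\<in>topspace X. \<exists>V\<in>\<U>. \<forall>f'\<in>topspace X. name f' = name f \<longrightarrow> \<alpha> (g i) f' \<in> V"
      using B[OF g] by blast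
    have "pattern_number \<U> k g \<le> card (name ` topspace X)"
      by (rule pattern_number_le_names[OF assms g name(1)]) (use name(3) in auto)
    with name show ?thesis by simp
  qed
  then show ?thesis by (metis (no_types, lifting) bounded_nat_set_is_finite imageE less_Suc_eq_le)
qed

lemma pattern_number_le_max:
  assumes "open_cover X \<U>" "g \<in> {1..k} \<rightarrow> carrier G"
  shows "pattern_number \<U> k g \<le> max_pattern_count X G \<alpha> \<U> k"
proof -
  \<comment> \<open>The maximum runs over extensional tuples, while \<open>g\<close> is arbitrary
    off \<open>{1..k}\<close>; only its values on that set matter.\<close>
  have "pattern_number \<U> k g = pattern_number \<U> k (restrict g {1..k})"
    unfolding pattern_number_def by (subst pattern_cover_cong[of k g "restrict g {1..k}"]) auto
  also have "\<dots> \<le> max_pattern_count X G \<alpha> \<U> k"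
    unfolding max_pattern_count_eq using assms
    by (intro Max_ge finite_pattern_numbers imageI) auto
  finally show ?thesis .
qed

lemma max_pattern_count_attained:
  assumes "open_cover X \<U>"
  obtains g where "g \<in> {1..k} \<rightarrow> carrier G" "max_pattern_count X G \<alpha> \<U> k = pattern_number \<U> k g"
proof -
  have "{1..k} \<rightarrow>\<^sub>E carrier G \<noteq> {}" using carrier_nonempty by (simp add: PiE_eq_empty_iff)
  then have "max_pattern_count X G \<alpha> \<U> k \<in> pattern_number \<U> k ` ({1..k} \<rightarrow>\<^sub>E carrier G)"
    unfolding max_pattern_count_eq by (intro Max_in finite_pattern_numbers assms) auto
  then show ?thesis using that by auto
qed

lemma max_pattern_count_pos:
  assumes "open_cover X \<U>" shows "max_pattern_count X G \<alpha> \<U> k \<ge> 1"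
proof -
  obtain g where "g \<in> {1..k} \<rightarrow> carrier G" "max_pattern_count X G \<alpha> \<U> k = pattern_number \<U> k g"
    by (rule max_pattern_count_attained[OF assms])
  then show ?thesis using pattern_number_pos[OF assms] by simp
qed

lemma max_pattern_count_add_le:
  assumes "open_cover X \<U>"
  shows "max_pattern_count X G \<alpha> \<U> (m + k) \<le> max_pattern_count X G \<alpha> \<U> m * max_pattern_count X G \<alpha> \<U> k"
proof -
  obtain g where g: "g \<in> {1..m + k} \<rightarrow> carrier G"
    "max_pattern_count X G \<alpha> \<U> (m + k) = pattern_number \<U> (m + k) g"
    by (rule max_pattern_count_attained[OF assms, of "m + k"])
  have "g \<in> {1..m} \<rightarrow> carrier G" "(\<lambda>i. g (m + i)) \<in> {1..k} \<rightarrow> carrier G" using g by auto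
  then have "pattern_number \<U> m g * pattern_number \<U> k (\<lambda>i. g (m + i))
      \<le> max_pattern_count X G \<alpha> \<U> m * max_pattern_count X G \<alpha> \<U> k"
    by (intro mult_le_mono pattern_number_le_max assms)
  then show ?thesis using g(2) pattern_number_add_le[OF assms g(1)] by linarith
qed

text \<open>The logarithms of the counts are subadditive, so \<open>lim\<close> in the definition
  denotes a genuine limit.\<close>

lemma cover_pattern_entropy_LIMSEQ:
  assumes "open_cover X \<U>"
  shows "(\<lambda>k. ln (real (max_pattern_count X G \<alpha> \<U> k)) / real k)
    \<longlonglongrightarrow> cover_pattern_entropy X G \<alpha> \<U>"
proof -
  let ?N = "max_pattern_count X G \<alpha> \<U>"
  have pos: "real (?N k) \<ge> 1" for k using max_pattern_count_pos[OF assms, of k] by simp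
  have "convergent (\<lambda>k. ln (real (?N k)) / real k)"
  proof (rule subadditive_convergent_average)
    fix m k
    have "real (?N (m + k)) \<le> real (?N m) * real (?N k)"
      using max_pattern_count_add_le[OF assms] by (metis of_nat_le_iff of_nat_mult)
    then have "ln (real (?N (m + k))) \<le> ln (real (?N m) * real (?N k))"
      using pos[of "m + k"] by (intro ln_mono) auto
    also have "\<dots> = ln (real (?N m)) + ln (real (?N k))"
      using pos[of m] pos[of k] by (intro ln_mult_pos) auto
    finally show "ln (real (?N (m + k))) \<le> ln (real (?N m)) + ln (real (?N k))" .
  qed (use pos in auto)
  then show ?thesis unfolding cover_pattern_entropy_def by (simp add: convergent_LIMSEQ_iff)
qed

text \<open>The polynomial factor contributes only \<open>O(log k / k)\<close> to the exponential
  rate.\<close>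

lemma cover_pattern_entropy_le_ln2:
  assumes cov: "open_cover X \<U>" and C: "C > 0"
    and bound: "\<And>k g. g \<in> {1..k} \<rightarrow> carrier G \<Longrightarrow>
      real (pattern_number \<U> k g) \<le> C * (real k + 1) ^ 4 * 2 ^ k"
  shows "cover_pattern_entropy X G \<alpha> \<U> \<le> ln 2"
proof (rule LIMSEQ_le[OF cover_pattern_entropy_LIMSEQ[OF cov]])
  show "(\<lambda>k. (ln C + 4 * ln (real k + 1) + real k * ln 2) / real k) \<longlonglongrightarrow> ln 2"
    by real_asymp
  have "ln (real (max_pattern_count X G \<alpha> \<U> k)) / real k
      \<le> (ln C + 4 * ln (real k + 1) + real k * ln 2) / real k" for k
  proof (rule divide_right_mono)
    obtain g where g: "g \<in> {1..k} \<rightarrow> carrier G"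
      "max_pattern_count X G \<alpha> \<U> k = pattern_number \<U> k g"
      by (rule max_pattern_count_attained[OF cov])
    have "ln (real (max_pattern_count X G \<alpha> \<U> k)) \<le> ln (C * (real k + 1) ^ 4 * 2 ^ k)"
      using bound[OF g(1)] pattern_number_pos[OF cov g(1)] unfolding g(2) by (intro ln_mono) auto
    also have "\<dots> = ln C + 4 * ln (real k + 1) + real k * ln 2"
      using C by (simp add: ln_mult_pos ln_realpow)
    finally show "ln (real (max_pattern_count X G \<alpha> \<U> k)) \<le> ln C + 4 * ln (real k + 1) + real k * ln 2" .
  qed simp
  then show "\<exists>N. \<forall>k\<ge>N. ln (real (max_pattern_count X G \<alpha> \<U> k)) / real k
      \<le> (ln C + 4 * ln (real k + 1) + real k * ln 2) / real k" by blast
qed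

lemma cover_pattern_entropy_ge_ln2:
  assumes cov: "open_cover X \<U>"
    and bound: "\<And>k. k \<ge> 1 \<Longrightarrow> \<exists>g\<in>{1..k} \<rightarrow> carrier G. 2 ^ k \<le> pattern_number \<U> k g"
  shows "ln 2 \<le> cover_pattern_entropy X G \<alpha> \<U>"
proof (rule LIMSEQ_le_const[OF cover_pattern_entropy_LIMSEQ[OF cov]])
  have "ln 2 \<le> ln (real (max_pattern_count X G \<alpha> \<U> k)) / real k" if k: "k \<ge> 1" for k
  proof -
    obtain g where g: "g \<in> {1..k} \<rightarrow> carrier G" "2 ^ k \<le> pattern_number \<U> k g"
      using bound[OF k] by blast
    have "2 ^ k \<le> max_pattern_count X G \<alpha> \<U> k"
      using g(2) pattern_number_le_max[OF cov g(1)] by linarith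
    then have "(2::real) ^ k \<le> real (max_pattern_count X G \<alpha> \<U> k)"
      by (metis of_nat_le_iff of_nat_numeral of_nat_power)
    then have "ln ((2::real) ^ k) \<le> ln (real (max_pattern_count X G \<alpha> \<U> k))" by (intro ln_mono) auto
    then show ?thesis using k by (simp add: ln_realpow field_simps)
  qed
  then show "\<exists>N. \<forall>k\<ge>N. ln 2 \<le> ln (real (max_pattern_count X G \<alpha> \<U> k)) / real k" by blast
qed

end

section \<open>Sets of integers with increasing gaps\<close>

lemma three_increasing:
  fixes S :: "int set"
  assumes "3 \<le> card S"
  obtains e1 e2 e3 where "e1 \<in> S" "e2 \<in> S" "e3 \<in> S" "e1 < e2" "e2 < e3"
proof -
  have fin: "finite S" and ne: "S \<noteq> {}" using assms by (auto intro: card_ge_0_finite)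
  have "card {Min S, Max S} < card S"
    using assms card_insert_le_m1[of 2 "{Max S}" "Min S"] by simp
  then have "\<not> S \<subseteq> {Min S, Max S}" using card_mono[of "{Min S, Max S}" S] by auto
  then obtain e where e: "e \<in> S" "e \<noteq> Min S" "e \<noteq> Max S" by blast
  show ?thesis
    using that[of "Min S" e "Max S"] e fin ne Min_le[OF fin e(1)] Max_ge[OF fin e(1)]
    by (simp add: order_less_le)
qed

text \<open>All triples are compared, not only neighbouring ones. This is stronger than growth of
  consecutive gaps, and it applies to any triple taken from an intersection.\<close>

definition gaps_increase :: "int set \<Rightarrow> bool" where
  "gaps_increase S \<longleftrightarrow>
     (\<forall>e1\<in>S. \<forall>e2\<in>S. \<forall>e3\<in>S. e1 < e2 \<longrightarrow> e2 < e3 \<longrightarrow> e2 - e1 < e3 - e2)"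

text \<open>Reflection swaps the two gaps of a triple, so a triple in both \<open>S\<close> and the
  reflection of \<open>R\<close> would have its first gap both smaller and larger than its second.
  Hence the overlap has at most two elements, and inclusion-exclusion inside \<open>E\<close> gives
  the bound. This is what keeps the two coordinates from costing \<open>2 ^ (2 * card E)\<close>
  patterns.\<close>

lemma gaps_increase_card_add_le:
  assumes E: "finite E" and S: "S \<subseteq> E" "gaps_increase S"
    and R: "R \<subseteq> uminus ` E" "gaps_increase R"
  shows "card S + card R \<le> card E + 2"
proof -
  have R': "uminus ` R \<subseteq> E" using R(1) by auto
  have fin: "finite S" "finite (uminus ` R)" using E S(1) R' finite_subset by blast+
  have "card (S \<inter> uminus ` R) < 3"
  proof (rule ccontr)
    assume "\<not> ?thesis"
    then have "3 \<le> card (S \<inter> uminus ` R)" by simp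
    then obtain e1 e2 e3 where e: "e1 \<in> S \<inter> uminus ` R" "e2 \<in> S \<inter> uminus ` R" "e3 \<in> S \<inter> uminus ` R"
      "e1 < e2" "e2 < e3" by (rule three_increasing)
    have "e2 - e1 < e3 - e2" using S(2) e unfolding gaps_increase_def by blast
    moreover have "- e1 \<in> R" "- e2 \<in> R" "- e3 \<in> R" using e by auto
    then have "- e2 - - e3 < - e1 - - e2" using R(2) e(4,5) unfolding gaps_increase_def by (meson neg_less_iff_less)
    ultimately show False by simp
  qed
  moreover have "card S + card (uminus ` R) = card (S \<union> uminus ` R) + card (S \<inter> uminus ` R)"
    by (rule card_Un_Int[OF fin])
  moreover have "card (uminus ` R) = card R" by (rule card_image) auto
  moreover have "card (S \<union> uminus ` R) \<le> card E" using E S(1) R' by (intro card_mono) auto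
  ultimately show ?thesis by linarith
qed

section \<open>The space and its labels\<close>

context X1_construction
begin

section \<open>Growth of the numbers \<open>n k q\<close>\<close>

lemma n_1_le:
  assumes "k \<ge> 1" "n k 1 > 0" "1 \<le> q" "q \<le> k"
  shows "n k 1 \<le> n k q"
  using assms(3,4)
proof (induction q rule: dec_induct)
  case (step q)
  then show ?case using n_step[of k q] assms by auto
qed simp

text \<open>The induction itself supplies the positivity required by \<open>n_1_le\<close>. The
  linear bound makes the tolerance \<open>k / 2\<close> in the choice of \<open>j\<close> harmless
  against the gaps.\<close>

lemma n_1_ge: "k \<ge> 1 \<Longrightarrow> n k 1 \<ge> 9 * int k"
proof (induction k rule: dec_induct)
  case (step k)
  then have "n k 1 \<le> n k k" by (intro n_1_le) auto
  then show ?case using n_next[of k] step by simp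
qed (use n_1_1 in simp)

lemma n_Suc: "k \<ge> 1 \<Longrightarrow> q < k \<Longrightarrow> n k (q + 1) > 100 * n k q"
  using n_step[of k q] n_0[of k] n_1_ge[of k] by (cases "q = 0") auto

lemma n_nonneg: "k \<ge> 1 \<Longrightarrow> q \<le> k \<Longrightarrow> n k q \<ge> 0"
  using n_1_le[of k q] n_1_ge[of k] n_0[of k] by (cases "q = 0") auto

lemma n_lacunary:
  assumes "k \<ge> 1" "q < q'" "q' \<le> k"
  shows "100 * n k q < n k q'"
proof -
  have "Suc q \<le> q'" using assms by simp
  then show ?thesis using assms(3)
  proof (induction q' rule: dec_induct)
    case base
    then show ?case using n_Suc[of k q] assms by simp
  next
    case (step q')
    then show ?case using n_Suc[of k q'] n_nonneg[of k q] assms by simp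
  qed
qed

lemma n_mono: "k \<ge> 1 \<Longrightarrow> q \<le> q' \<Longrightarrow> q' \<le> k \<Longrightarrow> n k q \<le> n k q'"
  using n_lacunary[of k q q'] n_nonneg[of k q] by (cases "q = q'") auto

lemma n_diagonal_mono:
  assumes "k \<le> k'" "1 \<le> k"
  shows "n k k \<le> n k' k'"
  using assms
proof (induction k' rule: dec_induct)
  case (step k')
  then show ?case using n_next[of k'] n_mono[of "k' + 1" 1 "k' + 1"] n_nonneg[of k' k'] by simp
qed simp_all

text \<open>Together with \<open>n_lacunary\<close>, this shows that the positive numbers
  \<open>n k q\<close>, ordered lexicographically by \<open>(k, q)\<close>, grow by a factor of more
  than 100 at each step.\<close>

lemma n_diagonal_lacunary:
  assumes "1 \<le> k" "k < k'" "1 \<le> q'" "q' \<le> k'"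
  shows "100 * n k k < n k' q'"
proof -
  obtain m where m: "k' = m + 1" "k \<le> m" using assms(2) by (metis Suc_eq_plus1 less_eq_Suc_le less_natE le_add1)
  then have "100 * n k k < n k' 1" using n_next[of m] n_diagonal_mono[of k m] assms by simp
  also have "\<dots> \<le> n k' q'" using assms by (intro n_mono) auto
  finally show ?thesis .
qed

lemma n_diagonal_ge: "k \<ge> 1 \<Longrightarrow> 9 * int k \<le> n k k"
  using n_1_ge[of k] n_mono[of k 1 k] by simp

section \<open>Cells met by the orbits \<open>x k s\<close>\<close>

lemma U_mono:
  assumes "k \<le> k'" "1 \<le> k"
  shows "U k' i \<subseteq> U k i"
  using assms
proof (induction k' rule: dec_induct)
  case (step k')
  then show ?case using U_decreasing[of k' i] by auto
qed simp_all

lemma word_bounds: "s \<in> words k \<Longrightarrow> q \<le> k \<Longrightarrow> s q = 0 \<or> s q = 1"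
  unfolding words_def by (auto simp: PiE_iff)

lemma j_bounds:
  assumes "k \<ge> 1" "s \<in> words k" "q < k"
  shows "n k (q + 1) - n k q - int k \<le> 2 * j k s (q + 1)"
    and "2 * j k s (q + 1) \<le> n k (q + 1) - n k q + int k"
proof -
  have "\<bar>real_of_int (n k (q + 1) - n k q) / 2 - real_of_int (j k s (q + 1))\<bar> \<le> real k / 2"
    using j_near[of k s "q + 1"] assms by simp
  then have "\<bar>real_of_int (n k (q + 1) - n k q - 2 * j k s (q + 1))\<bar> \<le> real_of_int (int k)"
    by (simp add: abs_if field_simps split: if_splits)
  then have "\<bar>n k (q + 1) - n k q - 2 * j k s (q + 1)\<bar> \<le> int k"
    by (metis of_int_abs of_int_le_iff)
  then show "n k (q + 1) - n k q - int k \<le> 2 * j k s (q + 1)"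
    and "2 * j k s (q + 1) \<le> n k (q + 1) - n k q + int k" by auto
qed

lemma x_forward:
  assumes "k \<ge> 1" "s \<in> words k" "q < k" "n k q \<le> t" "t < n k q + j k s (q + 1)"
  shows "x k s t \<in> U k (t - n k q + s q)"
  using x_first[of k s "q + 1" "t - n k q"] assms by (simp add: algebra_simps)

text \<open>\<open>p\<close> is chosen so that the second part of a block runs along the orbit that
  passes \<open>a (s (q + 1))\<close> at time \<open>n k (q + 1)\<close>, whereas
  \<open>x_forward\<close> follows the one that passes \<open>a (s q)\<close> at time
  \<open>n k q\<close>.\<close>

lemma x_backward:
  assumes "k \<ge> 1" "s \<in> words k" "q < k" "n k q + j k s (q + 1) \<le> t" "t \<le> n k (q + 1)"
  shows "x k s t \<in> U k (t - n k (q + 1) + s (q + 1))"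
proof -
  define i where "i = t - n k q - j k s (q + 1)"
  have "- p k s (q + 1) + i = t - n k (q + 1) + s (q + 1)" "t = n k q + j k s (q + 1) + i"
    using p_eq[of k s "q + 1"] assms by (auto simp: i_def)
  moreover have "x k s (n k q + j k s (q + 1) + i) \<in> U k (- p k s (q + 1) + i)"
    using x_second[of k s "q + 1" i] assms by (simp add: i_def)
  ultimately show ?thesis by metis
qed

text \<open>Beyond the last block the scale \<open>k + r\<close> improves with the distance
  \<open>r\<close>, so scale \<open>K\<close> is reached even by words with \<open>k < K\<close>
  once \<open>t\<close> is large.\<close>

lemma x_after:
  assumes "k \<ge> 1" "s \<in> words k" "n k k < t" "K \<ge> 1" "int K \<le> int k + (t - n k k)"
  shows "x k s t \<in> U K (t - n k k + s k)"
proof -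
  define r where "r = nat (t - n k k)"
  have r: "int r = t - n k k" "r \<ge> 1" using assms by (auto simp: r_def)
  have "x k s t \<in> U (k + r) (s k + int r)" using x_right[of k s r] assms r by simp
  moreover have "U (k + r) (s k + int r) \<subseteq> U K (s k + int r)" using assms r by (intro U_mono) auto
  ultimately show ?thesis using r by (auto simp: algebra_simps)
qed

lemma x_before:
  assumes "k \<ge> 1" "s \<in> words k" "t < 0" "K \<ge> 1" "int K \<le> int k - t"
  shows "x k s t \<in> U K (t + s 0)"
proof -
  define r where "r = nat (- t)"
  have r: "int r = - t" "r \<ge> 1" using assms by (auto simp: r_def)
  have "x k s t \<in> U (k + r) (s 0 - int r)" using x_left[of k s r] assms r by simp
  moreover have "U (k + r) (s 0 - int r) \<subseteq> U K (s 0 - int r)" using assms r by (intro U_mono) auto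
  ultimately show ?thesis using r by (auto simp: algebra_simps)
qed

lemma x_cell:
  assumes k: "k \<ge> 1" and s: "s \<in> words k"
  shows "\<exists>q\<le>k. x k s t \<in> U k (t - n k q + s q)"
proof -
  have between: "\<exists>q<m. n k q \<le> t \<and> t \<le> n k (q + 1)" if "m \<le> k" "0 \<le> t" "t \<le> n k m" "1 \<le> m" for m
    using that(4,1,2,3)
  proof (induction m rule: dec_induct)
    case base
    then show ?case using n_0[OF k] by (intro exI[of _ 0]) auto
  next
    case (step m)
    show ?case
    proof (cases "t \<le> n k m")
      case True
      then show ?thesis using step by (meson Suc_leD less_Suc_eq)
    next
      case False
      then show ?thesis using step by (intro exI[of _ m]) auto
    qed
  qed
  consider "t < 0" | "t > n k k" | "0 \<le> t" "t \<le> n k k" by linarith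
  then show ?thesis
  proof cases
    case 1
    then show ?thesis using x_before[OF k s 1 k] n_0[OF k] by (intro exI[of _ 0]) auto
  next
    case 2
    then show ?thesis using x_after[OF k s 2 k] by auto
  next
    case 3
    then obtain q where q: "q < k" "n k q \<le> t" "t \<le> n k (q + 1)" using between[of k] k by auto
    show ?thesis
    proof (cases "t < n k q + j k s (q + 1)")
      case True
      then show ?thesis using x_forward[OF k s q(1,2)] q(1) by (intro exI[of _ q]) auto
    next
      case False
      then show ?thesis using x_backward[OF k s q(1) _ q(3)] q(1) by (intro exI[of _ "q + 1"]) auto
    qed
  qed
qed

text \<open>Every gap between consecutive numbers \<open>n k q\<close> exceeds 99/100 of
  \<open>n k 1\<close>, hence \<open>2 * w + 2 + k\<close>. As \<open>j\<close> halves the gap up to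
  \<open>k / 2\<close>, each half covers the distance \<open>w\<close>, and on both sides of
  \<open>n k q\<close> the cells follow the letter \<open>s q\<close>.\<close>

lemma x_near:
  assumes k: "k \<ge> 1" and s: "s \<in> words k" and q: "q \<le> k"
    and w: "100 * (2 * w + 2 + int k) < 99 * n k 1" and t: "\<bar>t - n k q\<bar> \<le> w"
  shows "x k s t \<in> U k (t - n k q + s q)"
proof -
  have gap: "2 * w + 2 + int k < n k (q' + 1) - n k q'" if "q' < k" for q'
    using n_Suc[OF k that] n_mono[OF k, of 1 "q' + 1"] that w by auto
  show ?thesis
  proof (cases "n k q \<le> t")
    case True
    show ?thesis
    proof (cases "q = k")
      case False
      then have "q < k" using q by simp
      then show ?thesis
        using True t gap[of q] j_bounds(1)[OF k s, of q] by (intro x_forward k s) auto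
    next
      case qk: True
      obtain q' where q': "k = q' + 1" using k by (metis Suc_eq_plus1 not0_implies_Suc not_one_le_zero)
      then have q'k: "q' < k" by simp
      show ?thesis
      \<comment> \<open>\<open>x_right\<close> starts at \<open>r = 1\<close>; the time
        \<open>n k k\<close> itself is the last one of the preceding block.\<close>
      proof (cases "t = n k k")
        case tn: True
        have "n k q' + j k s (q' + 1) \<le> t"
          using j_bounds(2)[OF k s q'k] gap[OF q'k] tn t unfolding qk q'[symmetric] by linarith
        then show ?thesis using x_backward[OF k s q'k, of t] tn q' qk by simp
      next
        case False
        then show ?thesis using x_after[OF k s _ k, of t] True qk by simp
      qed
    qed
  next
    case False
    show ?thesis
    proof (cases "q = 0")
      case True
      then show ?thesis using False x_before[OF k s _ k, of t] n_0[OF k] by auto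
    next
      case q0: False
      then obtain q' where q': "q = q' + 1" by (metis Suc_eq_plus1 not0_implies_Suc)
      then have q'k: "q' < k" using q by simp
      have "n k q' + j k s (q' + 1) \<le> t"
        using j_bounds(2)[OF k s q'k] gap[OF q'k] t False unfolding q' by linarith
      then show ?thesis using x_backward[OF k s q'k, of t] False q' by simp
    qed
  qed
qed

text \<open>\<open>U_inf K\<close> is tested first because it contains the cells with
  \<open>\<bar>l\<bar> > n K K\<close>, which all share the label \<open>a_inf\<close>. Distinct
  cells are disjoint, which makes \<open>THE\<close> unique.\<close>

definition lab :: "nat \<Rightarrow> real^2 \<Rightarrow> real^2" where
  "lab K u = (if u \<in> U_inf K then a_inf else if \<exists>l. u \<in> U K l then a (THE l. u \<in> U K l) else u)"

lemma lab_cell: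
  assumes K: "K \<ge> 1" and u: "u \<in> U K l"
  shows "lab K u = (if \<bar>l\<bar> \<le> n K K then a l else a_inf)"
proof (cases "\<bar>l\<bar> \<le> n K K")
  case True
  have "(THE l. u \<in> U K l) = l" using U_disjoint[OF K] u by blast
  then show ?thesis using True u U_inf_disjoint[OF K True] by (auto simp: lab_def)
next
  case False
  then show ?thesis using u U_inf_contains[OF K, of l] by (auto simp: lab_def)
qed

lemma a_in_U: "K \<ge> 1 \<Longrightarrow> a l \<in> U K l"
  using U_nhd interior_subset by blast

lemma a_inf_in_U: "K \<ge> 1 \<Longrightarrow> a_inf \<in> U_inf K"
  using U_inf_nhd interior_subset by blast

lemma lab_a: "K \<ge> 1 \<Longrightarrow> lab K (a l) = (if \<bar>l\<bar> \<le> n K K then a l else a_inf)"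
  by (rule lab_cell) (auto intro: a_in_U)

lemma lab_a_inf: "K \<ge> 1 \<Longrightarrow> lab K a_inf = a_inf"
  using a_inf_in_U by (simp add: lab_def)

lemma cell_dist:
  assumes "K \<ge> 1" "u \<in> U K l" shows "dist u (a l) \<le> 1 / real K"
  using U_diameter[OF assms(1), of l] diameter_bounded_bound[OF _ assms(2) a_in_U[OF assms(1)]] by force

lemma cell_inf_dist:
  assumes "K \<ge> 1" "u \<in> U_inf K" shows "dist u a_inf \<le> 1 / real K"
  using U_inf_diameter[OF assms(1)] diameter_bounded_bound[OF _ assms(2) a_inf_in_U[OF assms(1)]] by force

lemma lab_dist:
  assumes K: "K \<ge> 1" shows "dist u (lab K u) \<le> 1 / real K"
proof (cases "u \<in> U_inf K")
  case True
  then show ?thesis using cell_inf_dist[OF K True] by (simp add: lab_def)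
next
  case False
  show ?thesis
  proof (cases "\<exists>l. u \<in> U K l")
    case True
    then obtain l where l: "u \<in> U K l" by blast
    then have "\<bar>l\<bar> \<le> n K K" using False U_inf_contains[OF K, of l] by force
    then show ?thesis using lab_cell[OF K l] cell_dist[OF K l] by simp
  qed (use False in \<open>simp add: lab_def\<close>)
qed

text \<open>\<open>n K K + 1\<close> is the window radius: cells with index beyond
  \<open>n K K\<close> carry the label \<open>a_inf\<close>, and a letter can shift the index by
  one. The inequality is the hypothesis of \<open>x_near\<close> for this radius.\<close>

lemma window_bound:
  assumes "K \<ge> 1" "K < k"
  shows "100 * (2 * (n K K + 1) + 2 + int k) < 99 * n k 1"
  using n_diagonal_lacunary[of K k 1] n_diagonal_ge[of K] n_1_ge[of k] assms by simp

lemma lab_x_near: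
  assumes K: "K \<ge> 1" "K < k" and s: "s \<in> words k" and q: "q \<le> k" "\<bar>t - n k q\<bar> \<le> n K K + 1"
  shows "lab K (x k s t) = lab K (a (t - n k q + s q))"
proof -
  have "x k s t \<in> U k (t - n k q + s q)"
    using x_near[OF _ s q(1) window_bound[OF K] q(2)] K by simp
  then have "x k s t \<in> U K (t - n k q + s q)" using U_mono[of K k] K by auto
  then show ?thesis using lab_cell[OF K(1)] lab_a[OF K(1)] by simp
qed

lemma lab_x_far:
  assumes K: "K \<ge> 1" "K < k" and s: "s \<in> words k"
    and far: "\<And>q. q \<le> k \<Longrightarrow> \<bar>t - n k q\<bar> > n K K + 1"
  shows "lab K (x k s t) = a_inf"
proof -
  obtain q where q: "q \<le> k" "x k s t \<in> U k (t - n k q + s q)" using x_cell[OF _ s, of t] K by auto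
  then have "x k s t \<in> U K (t - n k q + s q)" using U_mono[of K k] K by auto
  moreover have "\<bar>t - n k q + s q\<bar> > n K K" using far[OF q(1)] word_bounds[OF s q(1)] by auto
  ultimately show ?thesis using lab_cell[OF K(1)] by simp
qed

text \<open>To the right, more than \<open>n K K + K + 1\<close> steps remain after removing
  \<open>n k k \<le> n K K\<close>. This is enough to reach scale \<open>K\<close> and to push the
  cell index past \<open>n K K\<close>. To the left there is even more room, also when the letter
  moves the index by one.\<close>

lemma x_short_cell:
  assumes "1 \<le> k" "k \<le> K" and s: "s \<in> words k" and t: "\<bar>t\<bar> > 2 * n K K + int K + 1"
  shows "\<exists>l. \<bar>l\<bar> > n K K \<and> x k s t \<in> U K l"
proof -
  have M: "0 \<le> n k k" "n k k \<le> n K K" using n_diagonal_mono[of k K] n_nonneg[of k k] assms by auto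
  show ?thesis
  proof (cases "t < 0")
    case True
    then have "x k s t \<in> U K (t + s 0)" using assms M by (intro x_before) auto
    moreover have "\<bar>t + s 0\<bar> > n K K" using True t M word_bounds[OF s, of 0] by auto
    ultimately show ?thesis by blast
  next
    case False
    then have "x k s t \<in> U K (t - n k k + s k)" using assms M by (intro x_after) auto
    moreover have "\<bar>t - n k k + s k\<bar> > n K K" using False t M word_bounds[OF s, of k] by auto
    ultimately show ?thesis by blast
  qed
qed

text \<open>\<open>X_word\<close> contains \<open>a_inf\<close> by definition, so the disjointness
  assumptions alone allow equality. It is excluded because \<open>a_inf\<close> is fixed by
  \<open>T\<close> while successive points of the orbit differ.\<close>

lemma x_ne_a_inf:
  assumes "k \<ge> 1" "s \<in> words k" shows "x k s t \<noteq> a_inf"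
proof
  assume "x k s t = a_inf"
  then have "x k s (t + 1) = x k s t" using T_x[OF assms, of t] T_a_inf by simp
  then show False using x_distinct[OF assms] by (simp add: inj_eq)
qed

lemma x_ne_a:
  assumes "k \<ge> 1" "s \<in> words k" shows "x k s t \<noteq> a i"
proof
  assume "x k s t = a i"
  moreover have "x k s t \<in> X_word a_inf x k s" by (simp add: X_word_def)
  ultimately have "x k s t \<in> X_word a_inf x k s \<inter> (range a \<union> {a_inf})" by simp
  then show False using X_word_A[OF assms] x_ne_a_inf[OF assms] by blast
qed

lemma x_eq_x:
  assumes "k \<ge> 1" "s \<in> words k" "k' \<ge> 1" "s' \<in> words k'" "x k s t = x k' s' t'"
  shows "k = k' \<and> s = s' \<and> t = t'"
proof -
  have "x k s t \<in> X_word a_inf x k s" "x k' s' t' \<in> X_word a_inf x k' s'" by (simp_all add: X_word_def)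
  then have "x k s t \<in> X_word a_inf x k s \<inter> X_word a_inf x k' s'" using assms(5) by simp
  then have "(k, s) = (k', s')"
    using X_word_disjoint[OF assms(1-4)] x_ne_a_inf[OF assms(1,2)] by blast
  then show ?thesis using assms x_distinct[OF assms(1,2)] by (auto simp: inj_eq)
qed

section \<open>The explicit form of \<open>X1\<close> and its compactness\<close>

lemma closed_A: "closed (range a \<union> {a_inf})"
proof -
  have "z \<in> range a \<union> {a_inf}" if z: "z \<in> closure (range a \<union> {a_inf})" for z
  proof (rule ccontr)
    assume not: "z \<notin> range a \<union> {a_inf}"
    \<comment> \<open>With this radius the closed ball around \<open>a_inf\<close> misses
      \<open>z\<close> but contains all but finitely many of the points \<open>a i\<close>.\<close>
    define e where "e = dist z a_inf / 2"
    have e: "e > 0" using not by (simp add: e_def)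
    obtain N1 where N1: "\<And>i. i \<ge> N1 \<Longrightarrow> dist (a i) a_inf < e"
      using a_at_top e by (auto simp: tendsto_iff eventually_at_top_linorder)
    obtain N2 where N2: "\<And>i. i \<le> N2 \<Longrightarrow> dist (a i) a_inf < e"
      using a_at_bot e by (auto simp: tendsto_iff eventually_at_bot_linorder)
    have "range a \<union> {a_inf} \<subseteq> a ` {N2..N1} \<union> cball a_inf e"
    proof -
      have "a i \<in> a ` {N2..N1} \<union> cball a_inf e" for i
        using N1[of i] N2[of i] by (cases "i \<in> {N2..N1}") (auto simp: dist_commute)
      then have "range a \<subseteq> a ` {N2..N1} \<union> cball a_inf e" by blast
      then show ?thesis using e by simp
    qed
    moreover have "closed (a ` {N2..N1} \<union> cball a_inf e)" by (auto intro: finite_imp_closed)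
    ultimately have "z \<in> a ` {N2..N1} \<union> cball a_inf e" using z closure_minimal by blast
    then show False using not e by (auto simp: e_def dist_commute)
  qed
  then show ?thesis by (meson closure_subset_eq subsetI)
qed

definition X1' :: "(real^2) set" where
  "X1' = range a \<union> {a_inf} \<union> (\<Union>k\<in>{1..}. \<Union>s\<in>words k. range (x k s))"

lemma finite_words: "finite (words k)"
  unfolding words_def by (intro finite_PiE) auto

text \<open>Orbits of words with \<open>k > K\<close> lie in cells of scale \<open>K\<close> at all
  times, those of words with \<open>k \<le> K\<close> outside a bounded range of times. The finite
  set \<open>F\<close> collects the points in that range.\<close>

lemma X1'_covered:
  assumes K: "K \<ge> 1"
  shows "\<exists>F\<subseteq>X1'. finite F \<and> X1' \<subseteq> F \<union> (\<Union>l\<in>{- n K K..n K K}. U K l) \<union> U_inf K"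
proof -
  define L where "L = 2 * n K K + int K + 1"
  define F where "F = (\<Union>k\<in>{1..K}. \<Union>s\<in>words k. x k s ` {- L..L})"
  have cell: "u \<in> (\<Union>l\<in>{- n K K..n K K}. U K l) \<union> U_inf K" if "u \<in> U K l" for u l
  proof (cases "\<bar>l\<bar> \<le> n K K")
    case True
    then have "l \<in> {- n K K..n K K}" by auto
    then show ?thesis using that by blast
  next
    case False
    then show ?thesis using that U_inf_contains[OF K, of l] by auto
  qed
  have "x k s t \<in> F \<union> (\<Union>l\<in>{- n K K..n K K}. U K l) \<union> U_inf K" if k: "k \<ge> 1" and s: "s \<in> words k" for k s t
  proof (cases "k \<le> K")
    case True
    show ?thesis
    proof (cases "\<bar>t\<bar> \<le> L")
      case le: True
      then have "x k s t \<in> x k s ` {- L..L}" by (intro imageI) auto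
      moreover have "k \<in> {1..K}" using True k by simp
      ultimately show ?thesis using s unfolding F_def by blast
    next
      case False
      then show ?thesis using x_short_cell[OF k True s, of t] cell unfolding L_def by force
    qed
  next
    case False
    obtain q where "x k s t \<in> U k (t - n k q + s q)" using x_cell[OF k s] by blast
    then have "x k s t \<in> U K (t - n k q + s q)" using U_mono[of K k] K False by auto
    then show ?thesis using cell by blast
  qed
  then have "X1' \<subseteq> F \<union> (\<Union>l\<in>{- n K K..n K K}. U K l) \<union> U_inf K"
    using cell a_in_U[OF K] a_inf_in_U[OF K] unfolding X1'_def by blast
  moreover have "finite F" unfolding F_def using finite_words by auto
  moreover have "{1..K} \<subseteq> {1..}" by auto
  then have "F \<subseteq> X1'" unfolding F_def X1'_def by blast
  ultimately show ?thesis by blast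
qed

lemma closed_cells: "K \<ge> 1 \<Longrightarrow> finite F \<Longrightarrow>
    closed (F \<union> (\<Union>l\<in>{- n K K..n K K}. U K l) \<union> U_inf K)"
  using U_nhd U_inf_nhd by (intro closed_Un closed_UN) (auto intro: finite_imp_closed)

text \<open>A limit point \<open>z\<close> outside \<open>X1'\<close> is not among the finitely many
  exceptional points of any scale, so it lies in a cell of every scale. Its distance from the closed
  set \<open>range a \<union> {a_inf}\<close> is thus zero.\<close>

lemma closed_X1': "closed X1'"
proof -
  have "z \<in> X1'" if z: "z \<in> closure X1'" for z
  proof (rule ccontr)
    assume not: "z \<notin> X1'"
    have "\<exists>b\<in>range a \<union> {a_inf}. dist b z \<le> 1 / real K" if K: "K \<ge> 1" for K
    proof -
      obtain F where F: "F \<subseteq> X1'" "finite F" "X1' \<subseteq> F \<union> (\<Union>l\<in>{- n K K..n K K}. U K l) \<union> U_inf K"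
        using X1'_covered[OF K] by blast
      then have "z \<in> F \<union> (\<Union>l\<in>{- n K K..n K K}. U K l) \<union> U_inf K"
        using z closure_minimal[OF F(3) closed_cells[OF K F(2)]] by blast
      then consider l where "z \<in> U K l" | "z \<in> U_inf K" using F(1) not by blast
      then show ?thesis
      proof cases
        case 1
        then show ?thesis using cell_dist[OF K, of z l] by (intro bexI[of _ "a l"]) (auto simp: dist_commute)
      next
        case 2
        then show ?thesis using cell_inf_dist[OF K 2] by (intro bexI[of _ a_inf]) (auto simp: dist_commute)
      qed
    qed
    then have "z \<in> closure (range a \<union> {a_inf})"
      unfolding closure_approachable
      by (metis One_nat_def Suc_leI inverse_eq_divide le_less_trans of_nat_Suc reals_Archimedean zero_less_Suc)
    then show False using closed_A not unfolding X1'_def by simp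
  qed
  then show ?thesis by (meson closure_subset_eq subsetI)
qed

lemma compact_X1': "compact X1'"
proof -
  obtain F where F: "finite F" "X1' \<subseteq> F \<union> (\<Union>l\<in>{- n 1 1..n 1 1}. U 1 l) \<union> U_inf 1"
    using X1'_covered[of 1] by auto
  have "bounded (F \<union> (\<Union>l\<in>{- n 1 1..n 1 1}. U 1 l) \<union> U_inf 1)"
    using F(1) U_diameter[of 1] U_inf_diameter[of 1]
    unfolding bounded_Un by (intro conjI bounded_UN) (auto intro: finite_imp_bounded)
  then have "bounded X1'" using F(2) bounded_subset by blast
  then show ?thesis using closed_X1' compact_eq_bounded_closed by blast
qed

lemma zero_word: "(\<lambda>q\<in>{0..k}. 0) \<in> words k"
  unfolding words_def by auto

lemma X1_eq: "X1 a_inf x = X1'"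
proof
  show "X1 a_inf x \<subseteq> X1'"
    unfolding X1_def by (rule closure_minimal[OF _ closed_X1']) (auto simp: X1'_def X_word_def)
  let ?B = "\<Union>k\<in>{1..}. \<Union>s\<in>words k. X_word a_inf x k s"
  have xB: "x k s t \<in> ?B" if "k \<ge> 1" "s \<in> words k" for k s t
    using that unfolding X_word_def by auto
  have infB: "a_inf \<in> ?B" using zero_word[of 1] unfolding X_word_def by auto
  have "a l \<in> closure ?B" for l
    unfolding closure_approachable
  proof (intro allI impI)
    fix e :: real assume "e > 0"
    then obtain m where m: "1 / real (Suc m) < e" using nat_approx_posE by blast
    \<comment> \<open>\<open>K\<close> is large enough for \<open>l\<close> to lie in the window
      around time \<open>0\<close> and for the cells of scale \<open>K + 1\<close> to have diameter
      below \<open>e\<close>; the all-zero word then passes near \<open>a l\<close> at time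
      \<open>l\<close>.\<close>
    define K where "K = m + nat \<bar>l\<bar> + 1"
    define s :: "nat \<Rightarrow> int" where "s = (\<lambda>q\<in>{0..K + 1}. 0)"
    have s: "s \<in> words (K + 1)" unfolding s_def by (rule zero_word)
    have "\<bar>l - n (K + 1) 0\<bar> \<le> n K K + 1"
    proof -
      have "\<bar>l\<bar> \<le> int K" "K \<ge> 1" by (simp_all add: K_def)
      then show ?thesis using n_diagonal_ge[of K] n_0[of "K + 1"] by simp
    qed
    then have "x (K + 1) s l \<in> U (K + 1) (l - n (K + 1) 0 + s 0)"
      using window_bound[of K "K + 1"] s by (intro x_near[of "K + 1" s 0 "n K K + 1" l]) (auto simp: K_def)
    then have "x (K + 1) s l \<in> U (K + 1) l" using n_0[of "K + 1"] by (simp add: s_def)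
    then have "dist (x (K + 1) s l) (a l) \<le> 1 / real (K + 1)" by (intro cell_dist) auto
    also have "\<dots> \<le> 1 / real (Suc m)" by (intro divide_left_mono) (auto simp: K_def)
    finally show "\<exists>y\<in>?B. dist y (a l) < e" using m xB[OF _ s, of l] by (intro bexI[of _ "x (K + 1) s l"]) auto
  qed
  then show "X1' \<subseteq> X1 a_inf x"
    using xB infB closure_subset[of ?B] unfolding X1_def X1'_def by blast
qed

section \<open>Integer powers of \<open>T\<close>\<close>

abbreviation Tpow :: "int \<Rightarrow> real^2 \<Rightarrow> real^2" where
  "Tpow \<equiv> int_iterate (X1 a_inf x) T"

lemma X1_cases:
  assumes "u \<in> X1 a_inf x"
  obtains "u = a_inf" | i where "u = a i" | k s t where "k \<ge> 1" "s \<in> words k" "u = x k s t"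
  using assms unfolding X1_eq X1'_def by auto

lemma in_X1 [simp]: "a_inf \<in> X1 a_inf x" "a i \<in> X1 a_inf x"
  "k \<ge> 1 \<Longrightarrow> s \<in> words k \<Longrightarrow> x k s t \<in> X1 a_inf x"
  unfolding X1_eq X1'_def using atLeast_iff[of k 1] by blast+

lemma inj_on_T: "inj_on T (X1 a_inf x)"
proof (rule inj_onI)
  have [simp]: "a i \<noteq> a_inf" "a_inf \<noteq> a i" for i using a_distinct(2) by (metis rangeI)+
  note [simp] = T_a T_a_inf T_x
  fix u v assume u: "u \<in> X1 a_inf x" and v: "v \<in> X1 a_inf x" and eq: "T u = T v"
  from u show "u = v"
  proof (cases rule: X1_cases)
    case 1
    from v show ?thesis
      by (cases rule: X1_cases) (use eq 1 x_ne_a_inf in \<open>auto simp: eq_commute[of a_inf]\<close>)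
  next
    case (2 i)
    from v show ?thesis
      by (cases rule: X1_cases) (use eq 2 x_ne_a a_distinct(1) in \<open>auto simp: eq_commute[of "a _" "x _ _ _"] inj_eq\<close>)
  next
    case (3 k s t)
    from v show ?thesis
    proof (cases rule: X1_cases)
      case 1
      then show ?thesis using eq 3 x_ne_a_inf by auto
    next
      case (2 i)
      then show ?thesis using eq 3 x_ne_a by auto
    next
      case (3 k' s' t')
      then show ?thesis using eq \<open>u = x k s t\<close> x_eq_x[of k s k' s' "t + 1" "t' + 1"] \<open>1 \<le> k\<close> \<open>s \<in> words k\<close>
        by auto
    qed
  qed
qed

text \<open>Indexing whole orbits by the integers turns positive and negative powers of
  \<open>T\<close> alike into shifts of the index. Negative powers are iterates of
  \<open>inv_into\<close>, which \<open>inj_on_T\<close> evaluates along an orbit.\<close>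

definition orbit :: "(int \<Rightarrow> real^2) \<Rightarrow> bool" where
  "orbit y \<longleftrightarrow> (\<forall>t. y t \<in> X1 a_inf x \<and> T (y t) = y (t + 1))"

lemma orbits: "orbit a" "orbit (\<lambda>_. a_inf)" "k \<ge> 1 \<Longrightarrow> s \<in> words k \<Longrightarrow> orbit (x k s)"
  unfolding orbit_def by (auto simp: T_a T_a_inf T_x)

lemma orbit_shift: "orbit y \<Longrightarrow> orbit (\<lambda>t. y (c + t))"
  unfolding orbit_def by (simp add: add.assoc)

lemma Tpow_orbit:
  assumes "orbit y"
  shows "Tpow m (y t) = y (t + m)"
proof -
  have fwd: "(T ^^ r) (y t) = y (t + int r)" for r
    using assms by (induction r) (auto simp: orbit_def algebra_simps)
  have inv1: "inv_into (X1 a_inf x) T (y t) = y (t - 1)" for t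
  proof -
    have "T (y (t - 1)) = y t" "y (t - 1) \<in> X1 a_inf x"
      using assms unfolding orbit_def by (metis diff_add_cancel, blast)
    then show ?thesis using inv_into_f_f[OF inj_on_T] by metis
  qed
  have bwd: "(inv_into (X1 a_inf x) T ^^ r) (y t) = y (t - int r)" for r
    by (induction r) (auto simp: inv1 algebra_simps)
  show ?thesis unfolding int_iterate_def using fwd[of "nat m"] bwd[of "nat (- m)"] by auto
qed

lemma X1_orbit:
  assumes "u \<in> X1 a_inf x"
  obtains y where "orbit y" "y 0 = u"
  using assms
proof (cases rule: X1_cases)
  case 1
  then show ?thesis using that[OF orbits(2)] by simp
next
  case (2 i)
  then show ?thesis using that[OF orbit_shift[OF orbits(1), of i]] by simp
next
  case (3 k s t)
  then show ?thesis using that[OF orbit_shift[OF orbits(3)[of k s], of t]] by simp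
qed

lemma Tpow_closed: "u \<in> X1 a_inf x \<Longrightarrow> Tpow m u \<in> X1 a_inf x"
  using Tpow_orbit X1_orbit[of u] unfolding orbit_def by metis

lemma Tpow_add: "u \<in> X1 a_inf x \<Longrightarrow> Tpow m (Tpow m' u) = Tpow (m + m') u"
  using Tpow_orbit X1_orbit[of u] by (metis add.commute add_0)

lemma Tpow_0: "Tpow 0 u = u"
  by (simp add: int_iterate_def)

section \<open>Counting itineraries\<close>

definition itinerary :: "nat \<Rightarrow> int set \<Rightarrow> real^2 \<Rightarrow> int \<Rightarrow> real^2" where
  "itinerary K E u = (\<lambda>e\<in>E. lab K (Tpow e u))"

definition hits :: "nat \<Rightarrow> int set \<Rightarrow> nat \<Rightarrow> int \<Rightarrow> nat set" where
  "hits K E k i = {q. q \<le> k \<and> (\<exists>e\<in>E. \<bar>i + e - n k q\<bar> \<le> n K K + 1)}"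

definition multi_hits :: "nat \<Rightarrow> int set \<Rightarrow> (nat \<times> int) set" where
  "multi_hits K E = {(k, i). K < k \<and> 2 \<le> card (hits K E k i)}"

text \<open>Orbits whose labels differ from \<open>a_inf\<close> only in a bounded range of times
  (\<open>lab_short_orbit\<close>). The orbit \<open>a\<close> also stands in for long words of
  which only one window is seen.\<close>

definition short_orbits :: "nat \<Rightarrow> (int \<Rightarrow> real^2) set" where
  "short_orbits K = insert a (\<Union>k\<in>{1..K}. x k ` words k)"

lemma finite_hits: "finite (hits K E k i)"
  unfolding hits_def by (rule finite_subset[of _ "{..k}"]) auto

lemma finite_short_orbits: "finite (short_orbits K)"
  unfolding short_orbits_def using finite_words by auto

lemma lab_short_orbit:
  assumes "K \<ge> 1" "y \<in> short_orbits K" "\<bar>t\<bar> > 2 * n K K + int K + 1"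
  shows "lab K (y t) = a_inf"
proof -
  from assms(2) consider "y = a" | k s where "1 \<le> k" "k \<le> K" "s \<in> words k" "y = x k s"
    unfolding short_orbits_def by auto
  then show ?thesis
  proof cases
    case 1
    then show ?thesis using lab_a[OF assms(1), of t] n_diagonal_ge[OF assms(1)] assms(3) by auto
  next
    case 2
    obtain l where "\<bar>l\<bar> > n K K" "x k s t \<in> U K l" using x_short_cell[OF 2(1-3) assms(3)] by blast
    then show ?thesis using lab_cell[OF assms(1), of _ l] 2 by auto
  qed
qed

lemma window_separation:
  assumes K: "K \<ge> 1" "K < k" and q: "q < q'" "q' \<le> k"
  shows "n k q + 80 * n K K + 80 < n k q'"
proof -
  have "100 * n k q < n k q'" using n_lacunary[of k q q'] K q by simp
  moreover have "100 * n K K < n k q'" using n_diagonal_lacunary[of K k q'] K q by simp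
  moreover have "9 \<le> n K K" using n_diagonal_ge[OF K(1)] K by simp
  moreover have "0 \<le> n k q" using n_nonneg[of k q] K q by simp
  ultimately show ?thesis by linarith
qed

lemma window_unique:
  assumes K: "K \<ge> 1" "K < k" and "q \<le> k" "q' \<le> k"
    and "\<bar>t - n k q\<bar> \<le> n K K + 1" "\<bar>t - n k q'\<bar> \<le> n K K + 1"
  shows "q = q'"
proof (rule ccontr)
  assume "q \<noteq> q'"
  then have "q < q' \<or> q' < q" by linarith
  then show False
    using window_separation[OF K, of q q'] window_separation[OF K, of q' q] assms n_diagonal_ge[OF K(1)]
    by auto
qed

text \<open>The triple \<open>(y, d, e)\<close> says that time \<open>e\<close> finds the orbit
  \<open>y\<close> at an index \<open>d\<close> of the bounded range; the starting index is then
  \<open>d - e\<close>. The number of these itineraries is at most linear in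
  \<open>card E\<close>.\<close>

definition short_itineraries :: "nat \<Rightarrow> int set \<Rightarrow> (int \<Rightarrow> real^2) set" where
  "short_itineraries K E = insert (\<lambda>e\<in>E. a_inf)
     ((\<lambda>(y, d, e). \<lambda>e'\<in>E. lab K (y (d - e + e'))) `
        (short_orbits K \<times> {- (2 * n K K + int K + 1)..2 * n K K + int K + 1} \<times> E))"

lemma short_itinerary:
  assumes K: "K \<ge> 1" and y: "y \<in> short_orbits K"
  shows "(\<lambda>e\<in>E. lab K (y (i + e))) \<in> short_itineraries K E"
proof (cases "\<forall>e\<in>E. lab K (y (i + e)) = a_inf")
  case True
  then have "(\<lambda>e\<in>E. lab K (y (i + e))) = (\<lambda>e\<in>E. a_inf)" by (intro restrict_ext) auto
  then show ?thesis by (simp add: short_itineraries_def)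
next
  case False
  then obtain e where e: "e \<in> E" "lab K (y (i + e)) \<noteq> a_inf" by blast
  then have "\<bar>i + e\<bar> \<le> 2 * n K K + int K + 1" using lab_short_orbit[OF K y] by force
  then have "(y, i + e, e) \<in> short_orbits K \<times> {- (2 * n K K + int K + 1)..2 * n K K + int K + 1} \<times> E"
    using y e by auto
  then have "(\<lambda>(y, d, e). \<lambda>e'\<in>E. lab K (y (d - e + e'))) (y, i + e, e) \<in> short_itineraries K E"
    unfolding short_itineraries_def by (intro insertI2 imageI)
  then show ?thesis by simp
qed

text \<open>What a long word shows once the pair \<open>ki\<close> and the letters \<open>S\<close>
  of the windows met are known. For \<open>K < k\<close> the windows are disjoint
  (\<open>window_unique\<close>), so \<open>THE\<close> picks the only candidate.\<close>

definition long_itinerary :: "nat \<Rightarrow> int set \<Rightarrow> nat \<times> int \<Rightarrow> (nat \<Rightarrow> int) \<Rightarrow> int \<Rightarrow> real^2" where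
  "long_itinerary K E ki S = (\<lambda>e\<in>E. case ki of (k, i) \<Rightarrow>
     if \<exists>q\<le>k. \<bar>i + e - n k q\<bar> \<le> n K K + 1
     then let q = (THE q. q \<le> k \<and> \<bar>i + e - n k q\<bar> \<le> n K K + 1) in lab K (a (i + e - n k q + S q))
     else a_inf)"

text \<open>For a long word the number of windows met decides. With none the itinerary is constant.
  With one it equals the itinerary of some \<open>a l\<close>, which absorbs the infinitely many
  pairs \<open>(k, i)\<close> of this kind into a short orbit. With two or more the pair is in
  \<open>multi_hits\<close>, and the letters fix the rest.\<close>

lemma itinerary_cases:
  assumes K: "K \<ge> 1" and u: "u \<in> X1 a_inf x"
  shows "itinerary K E u \<in> short_itineraries K E \<union>
    (\<Union>ki\<in>multi_hits K E. long_itinerary K E ki ` (hits K E (fst ki) (snd ki) \<rightarrow>\<^sub>E {0, 1}))"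
  using u
proof (cases rule: X1_cases)
  case 1
  then have "itinerary K E u = (\<lambda>e\<in>E. a_inf)"
    unfolding itinerary_def using Tpow_orbit[OF orbits(2)] lab_a_inf[OF K] by auto
  then show ?thesis by (simp add: short_itineraries_def)
next
  case (2 i)
  then have "itinerary K E u = (\<lambda>e\<in>E. lab K (a (i + e)))"
    unfolding itinerary_def using Tpow_orbit[OF orbits(1)] by auto
  then show ?thesis using short_itinerary[OF K, of a] by (simp add: short_orbits_def)
next
  case (3 k s i)
  have it: "itinerary K E u = (\<lambda>e\<in>E. lab K (x k s (i + e)))"
    unfolding itinerary_def using Tpow_orbit[OF orbits(3)] 3 by auto
  show ?thesis
  proof (cases "k \<le> K")
    case True
    then have "x k s \<in> short_orbits K" using 3 unfolding short_orbits_def by auto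
    then show ?thesis using it short_itinerary[OF K] by simp
  next
    case False
    then have k: "K < k" by simp
    note near = lab_x_near[OF K k 3(2)] and far = lab_x_far[OF K k 3(2)]
    consider "card (hits K E k i) = 0" | "card (hits K E k i) = 1" | "card (hits K E k i) \<ge> 2"
      by linarith
    then show ?thesis
    proof cases
      case 1
      then have "hits K E k i = {}" using finite_hits by auto
      have "lab K (x k s (i + e)) = a_inf" if "e \<in> E" for e
      proof (rule far)
        fix q assume "q \<le> k"
        moreover have "q \<notin> hits K E k i" using \<open>hits K E k i = {}\<close> by simp
        ultimately show "\<bar>i + e - n k q\<bar> > n K K + 1" using that by (auto simp: hits_def not_le)
      qed
      then have "itinerary K E u = (\<lambda>e\<in>E. a_inf)" unfolding it by (intro restrict_ext)
      then show ?thesis by (simp add: short_itineraries_def)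
    next
      case 2
      then obtain q where q: "hits K E k i = {q}" by (auto simp: card_1_singleton_iff)
      then have qk: "q \<le> k" by (auto simp: hits_def)
      have "lab K (x k s (i + e)) = lab K (a ((i - n k q + s q) + e))" if e: "e \<in> E" for e
      proof (cases "\<bar>i + e - n k q\<bar> \<le> n K K + 1")
        case True
        then show ?thesis using near[OF qk True] by (simp add: algebra_simps)
      next
        case far_q: False
        have "lab K (x k s (i + e)) = a_inf"
        proof (rule far)
          fix q' assume q': "q' \<le> k"
          show "\<bar>i + e - n k q'\<bar> > n K K + 1"
          proof (rule ccontr)
            assume near_q': "\<not> ?thesis"
            then have "q' \<in> hits K E k i" using e q' by (auto simp: hits_def not_less)
            then show False using q far_q near_q' by auto
          qed
        qed
        \<comment> \<open>Outside the window the comparison orbit \<open>a\<close> has the label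
          \<open>a_inf\<close> as well, since the letter shifts the index by at most one.\<close>
        moreover have "\<bar>i - n k q + s q + e\<bar> > n K K" using far_q word_bounds[OF 3(2) qk] by auto
        ultimately show ?thesis using lab_a[OF K] by simp
      qed
      then have "itinerary K E u = (\<lambda>e\<in>E. lab K (a ((i - n k q + s q) + e)))"
        unfolding it by (intro restrict_ext)
      then show ?thesis using short_itinerary[OF K, of a] by (simp add: short_orbits_def)
    next
      case 3
      have ki: "(k, i) \<in> multi_hits K E" using 3 k by (simp add: multi_hits_def)
      define S where "S = restrict s (hits K E k i)"
      have S: "S \<in> hits K E k i \<rightarrow>\<^sub>E {0, 1}"
        using word_bounds[OF \<open>s \<in> words k\<close>] unfolding S_def by (auto simp: hits_def)
      have "itinerary K E u = long_itinerary K E (k, i) S"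
        unfolding it long_itinerary_def
      proof (intro restrict_ext)
        fix e assume e: "e \<in> E"
        show "lab K (x k s (i + e)) = (case (k, i) of (k, i) \<Rightarrow>
          if \<exists>q\<le>k. \<bar>i + e - n k q\<bar> \<le> n K K + 1
          then let q = (THE q. q \<le> k \<and> \<bar>i + e - n k q\<bar> \<le> n K K + 1) in lab K (a (i + e - n k q + S q))
          else a_inf)"
        proof (cases "\<exists>q\<le>k. \<bar>i + e - n k q\<bar> \<le> n K K + 1")
          case True
          then obtain q where q: "q \<le> k" "\<bar>i + e - n k q\<bar> \<le> n K K + 1" by blast
          have the: "(THE q. q \<le> k \<and> \<bar>i + e - n k q\<bar> \<le> n K K + 1) = q"
            using q window_unique[OF K k] by blast
          have "q \<in> hits K E k i" using q e by (auto simp: hits_def)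
          then have "S q = s q" by (simp add: S_def)
          then show ?thesis using True near[OF q] by (simp add: the Let_def)
        next
          case no: False
          then have "lab K (x k s (i + e)) = a_inf" by (intro far) (meson linorder_not_le)
          then show ?thesis using no by auto
        qed
      qed
      then show ?thesis using ki S by (intro UnI2 UN_I[OF ki]) auto
    qed
  qed
qed

text \<open>Two hits \<open>e1, e2\<close> at the positions \<open>n k q1 < n k q2\<close> have a distance close to \<open>n k q2\<close>, and
  by lacunarity of all the numbers \<open>n k q\<close> together this distance reveals \<open>k\<close> and \<open>q2\<close>.\<close>

lemma window_pair_determines:
  assumes K: "K \<ge> 1" "K < k" "K < k'" and q: "q1 < q2" "q2 \<le> k" and q': "q1' < q2'" "q2' \<le> k'"
    and hit: "\<bar>i + e1 - n k q1\<bar> \<le> n K K + 1" "\<bar>i + e2 - n k q2\<bar> \<le> n K K + 1"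
    and hit': "\<bar>i' + e1 - n k' q1'\<bar> \<le> n K K + 1" "\<bar>i' + e2 - n k' q2'\<bar> \<le> n K K + 1"
  shows "k = k' \<and> q2 = q2'"
proof -
  \<comment> \<open>If \<open>n k' q2'\<close> were that large, then up to window widths
    \<open>e2 - e1\<close> would be at most \<open>n k q2\<close> by the first pair of hits, but at
    least 99/100 of \<open>n k' q2'\<close> by the second. The claim is used in both directions, and
    lacunarity leaves only equality.\<close>
  have no: "\<not> 100 * n k q2 < n k' q2'"
    if K: "K \<ge> 1" "K < k" "K < k'" and q: "q1 < q2" "q2 \<le> k" and q': "q1' < q2'" "q2' \<le> k'"
      and hit: "\<bar>i + e1 - n k q1\<bar> \<le> n K K + 1" "\<bar>i + e2 - n k q2\<bar> \<le> n K K + 1"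
      and hit': "\<bar>i' + e1 - n k' q1'\<bar> \<le> n K K + 1" "\<bar>i' + e2 - n k' q2'\<bar> \<le> n K K + 1"
    for k k' q1 q2 q1' q2' i i'
  proof
    assume big: "100 * n k q2 < n k' q2'"
    have "100 * n k' q1' < n k' q2'" using n_lacunary[of k' q1' q2'] K q' by simp
    moreover have "100 * n K K < n k q2" using n_diagonal_lacunary[of K k q2] K q by simp
    moreover have "9 \<le> n K K" using n_diagonal_ge[OF K(1)] K by simp
    moreover have "0 \<le> n k q1" using n_nonneg[of k q1] K q by simp
    ultimately show False using hit hit' big by linarith
  qed
  have "\<not> 100 * n k q2 < n k' q2'" by (rule no[OF K q q' hit hit'])
  moreover have "\<not> 100 * n k' q2' < n k q2" by (rule no[OF K(1,3,2) q' q hit' hit])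
  moreover have "100 * n k q2 < n k' q2'" if "k < k'"
    using n_diagonal_lacunary[of k k' q2'] n_mono[of k q2 k] that K q q' by simp
  moreover have "100 * n k' q2' < n k q2" if "k' < k"
    using n_diagonal_lacunary[of k' k q2] n_mono[of k' q2' k'] that K q q' by simp
  moreover have "100 * n k q2 < n k q2'" if "k = k'" "q2 < q2'"
    using n_lacunary[of k q2 q2'] that K q q' by simp
  moreover have "100 * n k q2' < n k q2" if "k = k'" "q2' < q2"
    using n_lacunary[of k q2' q2] that K q q' by simp
  ultimately show ?thesis by (metis linorder_neqE_nat)
qed

text \<open>A pair \<open>(k, i)\<close> is encoded by times \<open>e1\<close>, \<open>e2\<close> in
  two of its windows and the offset \<open>d\<close> of the second from the centre of its window.
  The times determine \<open>k\<close> and \<open>q2\<close>, and the offset then gives back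
  \<open>i\<close>. There are \<open>2 * n K K + 3\<close> possible offsets.\<close>

lemma multi_hits_card:
  assumes K: "K \<ge> 1" and E: "finite E"
  shows "finite (multi_hits K E) \<and> card (multi_hits K E) \<le> (card E)\<^sup>2 * nat (2 * n K K + 3)"
proof -
  let ?w = "n K K + 1"
  let ?R = "E \<times> E \<times> {- ?w..?w}"
  have "\<exists>e1 e2 d q1 q2. (e1, e2, d) \<in> ?R \<and> q1 < q2 \<and> q2 \<le> k \<and> \<bar>i + e1 - n k q1\<bar> \<le> ?w \<and>
      \<bar>i + e2 - n k q2\<bar> \<le> ?w \<and> d = i + e2 - n k q2" if "(k, i) \<in> multi_hits K E" for k i
  proof -
    have c: "2 \<le> card (hits K E k i)" using that by (simp add: multi_hits_def)
    then obtain q q' where qq: "q \<in> hits K E k i" "q' \<in> hits K E k i" "q \<noteq> q'"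
      by (metis (no_types, opaque_lifting) card_le_Suc0_iff_eq finite_hits not_less_eq_eq numeral_2_eq_2)
    define q1 q2 where "q1 = min q q'" and "q2 = max q q'"
    have q: "q1 \<in> hits K E k i" "q2 \<in> hits K E k i" "q1 < q2"
      using qq by (auto simp: q1_def q2_def min_def max_def)
    then obtain e1 e2 where "e1 \<in> E" "\<bar>i + e1 - n k q1\<bar> \<le> ?w" "e2 \<in> E" "\<bar>i + e2 - n k q2\<bar> \<le> ?w"
      "q2 \<le> k" unfolding hits_def by blast
    then show ?thesis using q(3)
      by (intro exI[of _ e1] exI[of _ e2] exI[of _ "i + e2 - n k q2"] exI[of _ q1] exI[of _ q2]) auto
  qed
  then have "\<forall>ki\<in>multi_hits K E. \<exists>r\<in>?R. \<exists>q1 q2. q1 < q2 \<and> q2 \<le> fst ki \<and>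
      \<bar>snd ki + fst r - n (fst ki) q1\<bar> \<le> ?w \<and> \<bar>snd ki + fst (snd r) - n (fst ki) q2\<bar> \<le> ?w \<and>
      snd (snd r) = snd ki + fst (snd r) - n (fst ki) q2"
    by (fastforce simp: split_paired_all)
  then obtain f where f: "\<And>ki. ki \<in> multi_hits K E \<Longrightarrow> f ki \<in> ?R \<and> (\<exists>q1 q2. q1 < q2 \<and> q2 \<le> fst ki \<and>
      \<bar>snd ki + fst (f ki) - n (fst ki) q1\<bar> \<le> ?w \<and> \<bar>snd ki + fst (snd (f ki)) - n (fst ki) q2\<bar> \<le> ?w \<and>
      snd (snd (f ki)) = snd ki + fst (snd (f ki)) - n (fst ki) q2)" by metis
  have inj: "inj_on f (multi_hits K E)"
  proof (rule inj_onI)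
    fix ki ki' assume ki: "ki \<in> multi_hits K E" and ki': "ki' \<in> multi_hits K E" and eq: "f ki = f ki'"
    obtain q1 q2 where q: "q1 < q2" "q2 \<le> fst ki" "\<bar>snd ki + fst (f ki) - n (fst ki) q1\<bar> \<le> ?w"
      "\<bar>snd ki + fst (snd (f ki)) - n (fst ki) q2\<bar> \<le> ?w"
      "snd (snd (f ki)) = snd ki + fst (snd (f ki)) - n (fst ki) q2" using f[OF ki] by blast
    obtain q1' q2' where q': "q1' < q2'" "q2' \<le> fst ki'" "\<bar>snd ki' + fst (f ki) - n (fst ki') q1'\<bar> \<le> ?w"
      "\<bar>snd ki' + fst (snd (f ki)) - n (fst ki') q2'\<bar> \<le> ?w"
      "snd (snd (f ki)) = snd ki' + fst (snd (f ki)) - n (fst ki') q2'" using f[OF ki'] eq by metis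
    have "K < fst ki" "K < fst ki'" using ki ki' by (auto simp: multi_hits_def)
    then have "fst ki = fst ki' \<and> q2 = q2'"
      by (rule window_pair_determines[OF K _ _ q(1,2) q'(1,2) q(3,4) q'(3,4)])
    then show "ki = ki'" using q(5) q'(5) by (auto simp: prod_eq_iff)
  qed
  have sub: "f ` multi_hits K E \<subseteq> ?R" using f by blast
  have finR: "finite ?R" using E by simp
  have "card (multi_hits K E) \<le> card ?R" by (rule card_inj_on_le[OF inj sub finR])
  also have "\<dots> = (card E)\<^sup>2 * nat (2 * n K K + 3)"
    by (simp add: card_cartesian_product power2_eq_square algebra_simps)
  finally show ?thesis using inj_on_finite[OF inj sub finR] by blast
qed

text \<open>One time is picked in each window met. Windows are far apart, so the times are ordered
  like the centres; and \<open>n k q3 > 100 * n k q2\<close> makes the gap after \<open>e2\<close>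
  larger than the gap before it, which is at most \<open>n k q2\<close> up to window widths.\<close>

lemma hits_subset:
  assumes K: "K \<ge> 1" "K < k"
  obtains S where "S \<subseteq> E" "gaps_increase S" "card S = card (hits K E k i)"
proof -
  have "\<forall>q\<in>hits K E k i. \<exists>e\<in>E. \<bar>i + e - n k q\<bar> \<le> n K K + 1" by (auto simp: hits_def)
  then obtain f where f: "\<And>q. q \<in> hits K E k i \<Longrightarrow> f q \<in> E \<and> \<bar>i + f q - n k q\<bar> \<le> n K K + 1" by metis
  have le: "q \<le> k" if "q \<in> hits K E k i" for q using that by (auto simp: hits_def)
  have inj: "inj_on f (hits K E k i)"
    using window_unique[OF K] f le by (intro inj_onI) metis
  have mono: "q < q'" if "q \<in> hits K E k i" "q' \<in> hits K E k i" "f q < f q'" for q q'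
  proof (rule ccontr)
    assume "\<not> q < q'"
    then consider "q = q'" | "q' < q" by linarith
    then show False
    proof cases
      case 2
      then show False using window_separation[OF K 2 le[OF that(1)]] f[OF that(1)] f[OF that(2)] that(3)
          n_diagonal_ge[OF K(1)] K(1) by linarith
    qed (use that in simp)
  qed
  have "gaps_increase (f ` hits K E k i)"
    unfolding gaps_increase_def
  proof (intro ballI impI)
    fix e1 e2 e3 assume e: "e1 \<in> f ` hits K E k i" "e2 \<in> f ` hits K E k i" "e3 \<in> f ` hits K E k i"
      and e_lt: "e1 < e2" "e2 < e3"
    from e obtain q1 q2 q3 where q: "q1 \<in> hits K E k i" "q2 \<in> hits K E k i" "q3 \<in> hits K E k i"
      and fq: "e1 = f q1" "e2 = f q2" "e3 = f q3" by blast
    note lt = e_lt[unfolded fq]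
    have "q1 < q2" "q2 < q3" using mono q lt by auto
    then have "100 * n k q2 < n k q3" "100 * n K K < n k q2" "0 \<le> n k q1"
      using n_lacunary[of k q2 q3] n_diagonal_lacunary[of K k q2] n_nonneg[of k q1] K le[OF q(1)] le[OF q(2)]
        le[OF q(3)] by auto
    then show "e2 - e1 < e3 - e2" unfolding fq
      using f[OF q(1)] f[OF q(2)] f[OF q(3)] n_diagonal_ge[OF K(1)] K by linarith
  qed
  moreover have "f ` hits K E k i \<subseteq> E" using f by auto
  ultimately show ?thesis using that card_image[OF inj] by blast
qed

text \<open>\<open>S\<close> comes from a pair in \<open>multi_hits\<close> that meets the most
  windows (or is empty if there is none), so \<open>2 ^ card S\<close> bounds the patterns of every
  pair. The number of pairs is at most quadratic, that of short itineraries at most linear in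
  \<open>card E\<close>.\<close>

lemma itineraries_card:
  assumes K: "K \<ge> 1"
  obtains C where "\<And>E. finite E \<Longrightarrow> finite (itinerary K E ` X1 a_inf x) \<and>
    (\<exists>S\<subseteq>E. gaps_increase S \<and> card (itinerary K E ` X1 a_inf x) \<le> C * (card E + 1)\<^sup>2 * 2 ^ card S)"
proof -
  \<comment> \<open>Both constants depend on \<open>K\<close> alone: \<open>A\<close> counts the
    choices of orbit and index in \<open>short_itineraries\<close>, \<open>B\<close> the offsets in
    \<open>multi_hits_card\<close>.\<close>
  define A where "A = card (short_orbits K) * nat (2 * (2 * n K K + int K + 1) + 1)"
  define B where "B = nat (2 * n K K + 3)"
  have "finite (itinerary K E ` X1 a_inf x) \<and>
    (\<exists>S\<subseteq>E. gaps_increase S \<and> card (itinerary K E ` X1 a_inf x) \<le> (1 + A + B) * (card E + 1)\<^sup>2 * 2 ^ card S)"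
    if E: "finite E" for E
  proof -
    let ?D = "multi_hits K E"
    let ?h = "\<lambda>ki. card (hits K E (fst ki) (snd ki))"
    let ?L = "\<lambda>ki. long_itinerary K E ki ` (hits K E (fst ki) (snd ki) \<rightarrow>\<^sub>E {0, 1})"
    have D: "finite ?D" "card ?D \<le> (card E)\<^sup>2 * B" using multi_hits_card[OF K E] by (auto simp: B_def)
    have "\<exists>S\<subseteq>E. gaps_increase S \<and> (\<forall>ki\<in>?D. ?h ki \<le> card S)"
    proof (cases "?D = {}")
      case True
      then show ?thesis by (intro exI[of _ "{}"]) (auto simp: gaps_increase_def)
    next
      case False
      then have "Max (?h ` ?D) \<in> ?h ` ?D" using D(1) by (intro Max_in) auto
      then obtain ki where ki: "ki \<in> ?D" "?h ki = Max (?h ` ?D)" by auto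
      then have "K < fst ki" by (auto simp: multi_hits_def)
      from hits_subset[OF K this, of E "snd ki"] obtain S where
        S: "S \<subseteq> E" "gaps_increase S" "card S = ?h ki" by blast
      have "?h ki' \<le> card S" if "ki' \<in> ?D" for ki'
        unfolding S(3) ki(2) using that D(1) by (intro Max_ge) auto
      then show ?thesis using S by blast
    qed
    then obtain S where S: "S \<subseteq> E" "gaps_increase S" "\<And>ki. ki \<in> ?D \<Longrightarrow> ?h ki \<le> card S" by blast
    have finS: "finite (short_itineraries K E)"
      unfolding short_itineraries_def using finite_short_orbits E by simp
    have "card (short_itineraries K E) \<le> Suc (card (short_orbits K \<times>
        {- (2 * n K K + int K + 1)..2 * n K K + int K + 1} \<times> E))"
    proof -
      let ?P = "short_orbits K \<times> {- (2 * n K K + int K + 1)..2 * n K K + int K + 1} \<times> E"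
      let ?f = "\<lambda>(y, d, e). \<lambda>e'\<in>E. lab K (y (d - e + e'))"
      have finP: "finite ?P" using finite_short_orbits E by simp
      then have "card (?f ` ?P) \<le> card ?P" by (rule card_image_le)
      then show ?thesis unfolding short_itineraries_def
        using card_insert_if[of "?f ` ?P" "\<lambda>e\<in>E. a_inf"] finP by (simp split: if_splits del: card_cartesian_product)
    qed
    also have "\<dots> = 1 + A * card E" by (simp add: card_cartesian_product A_def algebra_simps)
    finally have cardS: "card (short_itineraries K E) \<le> 1 + A * card E" .
    have finL: "finite (?L ki)" for ki using finite_hits by (intro finite_imageI finite_PiE) auto
    have cardL: "card (?L ki) \<le> 2 ^ card S" if "ki \<in> ?D" for ki
    proof -
      have "card (?L ki) \<le> card (hits K E (fst ki) (snd ki) \<rightarrow>\<^sub>E {0, 1::int})"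
        using finite_hits by (intro card_image_le finite_PiE) auto
      also have "\<dots> = 2 ^ ?h ki" using finite_hits by (simp add: card_PiE numeral_2_eq_2)
      also have "\<dots> \<le> 2 ^ card S" using S(3)[OF that] by simp
      finally show ?thesis .
    qed
    have "card (\<Union>ki\<in>?D. ?L ki) \<le> (\<Sum>ki\<in>?D. card (?L ki))" by (rule card_UN_le[OF D(1)])
    also have "\<dots> \<le> card ?D * 2 ^ card S" using sum_bounded_above[of ?D, OF cardL] by simp
    also have "\<dots> \<le> (card E)\<^sup>2 * B * 2 ^ card S" using D(2) by simp
    finally have cardU: "card (\<Union>ki\<in>?D. ?L ki) \<le> (card E)\<^sup>2 * B * 2 ^ card S" .
    have sub: "itinerary K E ` X1 a_inf x \<subseteq> short_itineraries K E \<union> (\<Union>ki\<in>?D. ?L ki)"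
      using itinerary_cases[OF K] by blast
    have fin: "finite (short_itineraries K E \<union> (\<Union>ki\<in>?D. ?L ki))" using finS finL D(1) by blast
    have "card (itinerary K E ` X1 a_inf x) \<le> card (short_itineraries K E \<union> (\<Union>ki\<in>?D. ?L ki))"
      by (rule card_mono[OF fin sub])
    also have "\<dots> \<le> (1 + A * card E) + (card E)\<^sup>2 * B * 2 ^ card S"
      using card_Un_le[of "short_itineraries K E" "\<Union>ki\<in>?D. ?L ki"] cardS cardU by linarith
    also have "\<dots> \<le> (1 + A) * (card E + 1)\<^sup>2 * 2 ^ card S + B * (card E + 1)\<^sup>2 * 2 ^ card S"
    proof (rule add_mono)
      have "1 + A * card E \<le> (1 + A) * (card E + 1)\<^sup>2 * 1"
        by (simp add: power2_eq_square algebra_simps)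
      also have "\<dots> \<le> (1 + A) * (card E + 1)\<^sup>2 * 2 ^ card S" by (intro mult_left_mono) auto
      finally show "1 + A * card E \<le> (1 + A) * (card E + 1)\<^sup>2 * 2 ^ card S" .
      have "(card E)\<^sup>2 \<le> (card E + 1)\<^sup>2" by (intro power_mono) auto
      then show "(card E)\<^sup>2 * B * 2 ^ card S \<le> B * (card E + 1)\<^sup>2 * 2 ^ card S"
        by (simp add: mult.commute)
    qed
    also have "\<dots> = (1 + A + B) * (card E + 1)\<^sup>2 * 2 ^ card S" by (simp add: algebra_simps)
    finally show ?thesis using finite_subset[OF sub fin] S(1,2) by blast
  qed
  then show ?thesis using that by blast
qed

lemma itineraries_pair_card:
  assumes K: "K \<ge> 1"
  obtains C where "C > 0" "\<And>E. finite E \<Longrightarrow>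
    finite (itinerary K E ` X1 a_inf x) \<and> finite (itinerary K (uminus ` E) ` X1 a_inf x) \<and>
    card (itinerary K E ` X1 a_inf x) * card (itinerary K (uminus ` E) ` X1 a_inf x)
      \<le> C * (card E + 1) ^ 4 * 2 ^ card E"
proof -
  obtain C where C: "\<And>E. finite E \<Longrightarrow> finite (itinerary K E ` X1 a_inf x) \<and>
    (\<exists>S\<subseteq>E. gaps_increase S \<and> card (itinerary K E ` X1 a_inf x) \<le> C * (card E + 1)\<^sup>2 * 2 ^ card S)"
    using itineraries_card[OF K] by blast
  show ?thesis
  \<comment> \<open>The factor \<open>4\<close> is \<open>2 ^ 2\<close>, from the possible overlap
    in two elements; the summand \<open>1\<close> makes the constant positive.\<close>
  proof (rule that[of "4 * C * C + 1"])
    fix E :: "int set" assume E: "finite E"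
    have cE: "card (uminus ` E) = card E" by (rule card_image) auto
    obtain S where S: "S \<subseteq> E" "gaps_increase S"
      "card (itinerary K E ` X1 a_inf x) \<le> C * (card E + 1)\<^sup>2 * 2 ^ card S" using C[OF E] by blast
    obtain R where R: "R \<subseteq> uminus ` E" "gaps_increase R"
      "card (itinerary K (uminus ` E) ` X1 a_inf x) \<le> C * (card E + 1)\<^sup>2 * 2 ^ card R"
      using C[of "uminus ` E"] E cE by auto
    have "card (itinerary K E ` X1 a_inf x) * card (itinerary K (uminus ` E) ` X1 a_inf x)
      \<le> (C * (card E + 1)\<^sup>2 * 2 ^ card S) * (C * (card E + 1)\<^sup>2 * 2 ^ card R)"
      by (rule mult_le_mono[OF S(3) R(3)])
    also have "\<dots> = C * C * (card E + 1) ^ 4 * 2 ^ (card S + card R)"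
    proof -
      have "(card E + 1) ^ 4 = (card E + 1)\<^sup>2 * (card E + 1)\<^sup>2" by (simp flip: power_add)
      then show ?thesis by (simp only: power_add mult_ac)
    qed
    also have "\<dots> \<le> C * C * (card E + 1) ^ 4 * 2 ^ (card E + 2)"
      using gaps_increase_card_add_le[OF E S(1,2) R(1,2)] by (intro mult_left_mono power_increasing) auto
    also have "\<dots> = 4 * C * C * ((card E + 1) ^ 4 * 2 ^ card E)" by simp
    also have "\<dots> \<le> (4 * C * C + 1) * ((card E + 1) ^ 4 * 2 ^ card E)" by (intro mult_right_mono) auto
    also have "\<dots> = (4 * C * C + 1) * (card E + 1) ^ 4 * 2 ^ card E" by (simp only: mult.assoc)
    finally show "finite (itinerary K E ` X1 a_inf x) \<and> finite (itinerary K (uminus ` E) ` X1 a_inf x) \<and>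
      card (itinerary K E ` X1 a_inf x) * card (itinerary K (uminus ` E) ` X1 a_inf x)
      \<le> (4 * C * C + 1) * (card E + 1) ^ 4 * 2 ^ card E" using C E by blast
  qed simp
qed

end

section \<open>The co-induced system\<close>

definition dih_C :: "(int \<times> int) set" where
  "dih_C = UNIV \<times> {1}"

lemma dih_carrier: "carrier dih_group = UNIV \<times> {0, 1}"
proof -
  have "{0..<2} = {0, 1 :: int}" by auto
  then show ?thesis by (simp add: dih_group_def semidirect_product_def integer_mod_group_def)
qed

lemma dih_carrierE:
  assumes "g \<in> carrier dih_group"
  obtains m where "g = (m, 0)" | m where "g = (m, 1)"
  using assms unfolding dih_carrier by blast

lemma dih_mult: "(m, c) \<otimes>\<^bsub>dih_group\<^esub> (m', c') = (m + (if c = 0 then m' else - m'), (c + c') mod 2)"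
  by (simp add: dih_group_def semidirect_product_def)

lemma dih_one: "\<one>\<^bsub>dih_group\<^esub> = (0, 0)"
  by (simp add: dih_group_def semidirect_product_def)

lemma dih_is_group: "group dih_group"
proof (rule groupI)
  fix g h k assume g: "g \<in> carrier dih_group" and h: "h \<in> carrier dih_group" and k: "k \<in> carrier dih_group"
  show "g \<otimes>\<^bsub>dih_group\<^esub> h \<in> carrier dih_group"
    by (rule dih_carrierE[OF g]; rule dih_carrierE[OF h]) (simp_all add: dih_mult dih_carrier)
  show "g \<otimes>\<^bsub>dih_group\<^esub> h \<otimes>\<^bsub>dih_group\<^esub> k = g \<otimes>\<^bsub>dih_group\<^esub> (h \<otimes>\<^bsub>dih_group\<^esub> k)"
    by (rule dih_carrierE[OF g]; rule dih_carrierE[OF h]; rule dih_carrierE[OF k]) (simp_all add: dih_mult)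
next
  fix g assume g: "g \<in> carrier dih_group"
  show "\<one>\<^bsub>dih_group\<^esub> \<otimes>\<^bsub>dih_group\<^esub> g = g"
    by (rule dih_carrierE[OF g]) (simp_all add: dih_mult dih_one)
  show "\<exists>h\<in>carrier dih_group. h \<otimes>\<^bsub>dih_group\<^esub> g = \<one>\<^bsub>dih_group\<^esub>"
  proof (rule dih_carrierE[OF g])
    fix m assume "g = (m, 0)"
    then show ?thesis by (intro bexI[of _ "(- m, 0)"]) (simp_all add: dih_mult dih_one dih_carrier)
  next
    fix m assume "g = (m, 1)"
    then show ?thesis by (intro bexI[of _ "(m, 1)"]) (simp_all add: dih_mult dih_one dih_carrier)
  qed
qed (simp add: dih_one dih_carrier)

lemma dih_inv:
  "inv\<^bsub>dih_group\<^esub> (m, 0) = (- m, 0)" "inv\<^bsub>dih_group\<^esub> (m, 1) = (m, 1)"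
proof -
  show "inv\<^bsub>dih_group\<^esub> (m, 0) = (- m, 0)"
    by (rule group.inv_equality[OF dih_is_group]) (simp_all add: dih_carrier dih_mult dih_one)
  show "inv\<^bsub>dih_group\<^esub> (m, 1) = (m, 1)"
    by (rule group.inv_equality[OF dih_is_group]) (simp_all add: dih_carrier dih_mult dih_one)
qed

lemma dih_r_coset:
  "dih_Z #>\<^bsub>dih_group\<^esub> (m, 0) = dih_Z" "dih_Z #>\<^bsub>dih_group\<^esub> (m, 1) = dih_C"
  "dih_C #>\<^bsub>dih_group\<^esub> (m, 0) = dih_C" "dih_C #>\<^bsub>dih_group\<^esub> (m, 1) = dih_Z"
proof -
  have 1: "\<exists>k. m' = k + m" for m' :: int by (rule exI[of _ "m' - m"]) simp
  have 2: "\<exists>k. m' = k - m" for m' :: int by (rule exI[of _ "m' + m"]) simp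
  show "dih_Z #>\<^bsub>dih_group\<^esub> (m, 0) = dih_Z" "dih_Z #>\<^bsub>dih_group\<^esub> (m, 1) = dih_C"
    "dih_C #>\<^bsub>dih_group\<^esub> (m, 0) = dih_C" "dih_C #>\<^bsub>dih_group\<^esub> (m, 1) = dih_Z"
    using 1 2 by (auto simp: r_coset_def dih_Z_def dih_C_def dih_mult)
qed

lemma dih_Z_ne_C: "dih_Z \<noteq> dih_C" "dih_C \<noteq> dih_Z"
proof -
  have "(0, 0) \<in> dih_Z" "(0, 0) \<notin> dih_C" by (simp_all add: dih_Z_def dih_C_def)
  then show "dih_Z \<noteq> dih_C" "dih_C \<noteq> dih_Z" by metis+
qed

lemma dih_rcosets: "rcosets\<^bsub>dih_group\<^esub> dih_Z = {dih_Z, dih_C}"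
proof -
  have "rcosets\<^bsub>dih_group\<^esub> dih_Z = (\<Union>m. {dih_Z #>\<^bsub>dih_group\<^esub> (m, 0), dih_Z #>\<^bsub>dih_group\<^esub> (m, 1)})"
    unfolding RCOSETS_def dih_carrier by blast
  then show ?thesis by (simp add: dih_r_coset)
qed

text \<open>The point \<open>(u, v)\<close> of \<open>X \<times> X\<close>, with \<open>u\<close> at the trivial coset.\<close>

definition coset_pair :: "'x \<Rightarrow> 'x \<Rightarrow> (int \<times> int) set \<Rightarrow> 'x" where
  "coset_pair u v = (\<lambda>\<theta>\<in>{dih_Z, dih_C}. if \<theta> = dih_Z then u else v)"

lemma coset_pair_simps [simp]: "coset_pair u v dih_Z = u" "coset_pair u v dih_C = v"
  by (simp_all add: coset_pair_def dih_Z_ne_C)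

lemma topspace_coind: "topspace (coind_space dih_group dih_Z (top_of_set X)) = {dih_Z, dih_C} \<rightarrow>\<^sub>E X"
  by (simp add: coind_space_def dih_rcosets)

lemma coset_pair_in [simp]: "coset_pair u v \<in> {dih_Z, dih_C} \<rightarrow>\<^sub>E X \<longleftrightarrow> u \<in> X \<and> v \<in> X"
  by (simp add: PiE_iff) (simp add: coset_pair_def)

lemma coset_pair_eq: "f \<in> {dih_Z, dih_C} \<rightarrow>\<^sub>E X \<Longrightarrow> coset_pair (f dih_Z) (f dih_C) = f"
  by (rule PiE_ext[of _ "{dih_Z, dih_C}" "\<lambda>_. UNIV"]) (auto simp: PiE_iff coset_pair_def dih_Z_ne_C)

text \<open>This carries covers of the co-induced space back to the metric space
  \<open>X \<times> X\<close>, where a Lebesgue number becomes available.\<close>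

lemma coset_pair_continuous:
  fixes X :: "'x::topological_space set"
  shows "continuous_map (top_of_set (X \<times> X)) (product_topology (\<lambda>_. top_of_set X) {dih_Z, dih_C})
     (\<lambda>(u, v). coset_pair u v)"
proof -
  have "continuous_map (top_of_set (X \<times> X)) (top_of_set X) fst"
    "continuous_map (top_of_set (X \<times> X)) (top_of_set X) snd"
    by (auto intro: continuous_intros)
  then show ?thesis
    by (auto simp: continuous_map_componentwise case_prod_unfold coset_pair_def dih_Z_ne_C)
qed

text \<open>The minus sign arises when the representative \<open>(0, 1)\<close> of the nontrivial
  coset is moved past \<open>m\<close>.\<close>

lemma coind_action_dih:
  "coind_action dih_group dih_Z dih_section (dih_Z_action X T) (m, 0) f =
     coset_pair (int_iterate X T m (f dih_Z)) (int_iterate X T (- m) (f dih_C))"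
  "coind_action dih_group dih_Z dih_section (dih_Z_action X T) (m, 1) f =
     coset_pair (int_iterate X T m (f dih_C)) (int_iterate X T (- m) (f dih_Z))"
proof -
  have "dih_section dih_Z = (0, 0)" "dih_section dih_C = (0, 1)"
    by (simp_all add: dih_section_def dih_Z_ne_C)
  note eqs = this dih_r_coset dih_Z_ne_C dih_mult dih_inv dih_Z_action_def
  show "coind_action dih_group dih_Z dih_section (dih_Z_action X T) (m, 0) f =
     coset_pair (int_iterate X T m (f dih_Z)) (int_iterate X T (- m) (f dih_C))"
    unfolding coind_action_def dih_rcosets coset_pair_def
    by (rule restrict_ext, elim insertE emptyE) (simp_all add: eqs)
  show "coind_action dih_group dih_Z dih_section (dih_Z_action X T) (m, 1) f =
     coset_pair (int_iterate X T m (f dih_C)) (int_iterate X T (- m) (f dih_Z))"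
    unfolding coind_action_def dih_rcosets coset_pair_def
    by (rule restrict_ext, elim insertE emptyE) (simp_all add: eqs)
qed

section \<open>The action on the co-induced space\<close>

context X1_construction
begin

abbreviation coind_X :: "((int \<times> int) set \<Rightarrow> real^2) topology" where
  "coind_X \<equiv> coind_space dih_group dih_Z (top_of_set (X1 a_inf x))"

abbreviation coind_T :: "int \<times> int \<Rightarrow> ((int \<times> int) set \<Rightarrow> real^2) \<Rightarrow> (int \<times> int) set \<Rightarrow> real^2" where
  "coind_T \<equiv> coind_action dih_group dih_Z dih_section (dih_Z_action (X1 a_inf x) T)"

lemma coind_T_closed:
  assumes "g \<in> carrier dih_group" "f \<in> topspace coind_X"
  shows "coind_T g f \<in> topspace coind_X"
proof -
  obtain m c where g: "g = (m, c)" "c = 0 \<or> c = 1" using assms by (auto simp: dih_carrier)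
  have "f dih_Z \<in> X1 a_inf x" "f dih_C \<in> X1 a_inf x" using assms by (auto simp: topspace_coind PiE_iff)
  then show ?thesis using g(2) unfolding g(1)
    by (elim disjE) (simp_all only: coind_action_dih topspace_coind coset_pair_in Tpow_closed simp_thms)
qed

lemma coind_T_inv:
  assumes "g \<in> carrier dih_group" "f \<in> topspace coind_X"
  shows "coind_T (inv\<^bsub>dih_group\<^esub> g) (coind_T g f) = f"
proof -
  obtain m c where g: "g = (m, c)" "c = 0 \<or> c = 1" using assms by (auto simp: dih_carrier)
  have "f dih_Z \<in> X1 a_inf x" "f dih_C \<in> X1 a_inf x" using assms by (auto simp: topspace_coind PiE_iff)
  then have "coind_T (inv\<^bsub>dih_group\<^esub> g) (coind_T g f) = coset_pair (f dih_Z) (f dih_C)"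
    using g by (auto simp: coind_action_dih dih_inv Tpow_add Tpow_0)
  then show ?thesis using coset_pair_eq assms(2) unfolding topspace_coind by metis
qed

sublocale pattern_system coind_X dih_group coind_T
proof
  have "coset_pair a_inf a_inf \<in> topspace coind_X" by (simp add: topspace_coind)
  then show "topspace coind_X \<noteq> {}" by blast
  have "compact_space (top_of_set (X1 a_inf x))"
    using compact_X1' by (simp add: X1_eq compact_space_subtopology)
  then show "compact_space coind_X"
    unfolding coind_space_def by (simp add: compact_space_product_topology)
  show "carrier dih_group \<noteq> {}" by (simp add: dih_carrier)
  fix g V f assume g: "g \<in> carrier dih_group" and V: "V \<subseteq> topspace coind_X" and f: "f \<in> topspace coind_X"
  have inv: "inv\<^bsub>dih_group\<^esub> g \<in> carrier dih_group" "inv\<^bsub>dih_group\<^esub> (inv\<^bsub>dih_group\<^esub> g) = g"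
    using g group.inv_closed[OF dih_is_group] group.inv_inv[OF dih_is_group] by auto
  show "f \<in> coind_T (inv\<^bsub>dih_group\<^esub> g) ` V \<longleftrightarrow> coind_T g f \<in> V"
  proof
    assume "f \<in> coind_T (inv\<^bsub>dih_group\<^esub> g) ` V"
    then obtain h where h: "h \<in> V" "f = coind_T (inv\<^bsub>dih_group\<^esub> g) h" by blast
    then have "coind_T g f = h" using coind_T_inv[OF inv(1), of h] V inv(2) by auto
    then show "coind_T g f \<in> V" using h by simp
  next
    assume "coind_T g f \<in> V"
    then show "f \<in> coind_T (inv\<^bsub>dih_group\<^esub> g) ` V" using coind_T_inv[OF g f] by force
  qed
qed (rule coind_T_closed)

section \<open>Upper bound\<close>

lemma lab_in_X1: "u \<in> X1 a_inf x \<Longrightarrow> lab K u \<in> X1 a_inf x"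
  unfolding lab_def by simp

text \<open>A Lebesgue number of the cover, transported to \<open>X1 \<times> X1\<close>, fixes
  \<open>K\<close>: all pairs with given labels lie in the ball of that radius around the pair of
  labels.\<close>

lemma cover_labels:
  assumes cov: "open_cover coind_X \<U>"
  obtains K where "K \<ge> 1" "\<And>u v. u \<in> X1 a_inf x \<Longrightarrow> v \<in> X1 a_inf x \<Longrightarrow>
    \<exists>V\<in>\<U>. \<forall>u'\<in>X1 a_inf x. \<forall>v'\<in>X1 a_inf x. lab K u' = lab K u \<longrightarrow> lab K v' = lab K v \<longrightarrow>
      coset_pair u' v' \<in> V"
proof -
  let ?X = "X1 a_inf x"
  let ?S = "?X \<times> ?X"
  define \<G> where "\<G> = {W. open W \<and> (\<exists>V\<in>\<U>. \<forall>z\<in>?S \<inter> W. coset_pair (fst z) (snd z) \<in> V)}"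
  have "compact ?S" using compact_X1' by (simp add: X1_eq compact_Times)
  moreover have "?S \<subseteq> \<Union>\<G>"
  proof
    fix z assume z: "z \<in> ?S"
    then have "coset_pair (fst z) (snd z) \<in> topspace coind_X" by (auto simp: topspace_coind)
    then obtain V where V: "V \<in> \<U>" "coset_pair (fst z) (snd z) \<in> V"
      using cov unfolding open_cover_def by blast
    have "openin coind_X V" using cov V unfolding open_cover_def by blast
    then have "openin (top_of_set ?S) {z \<in> ?S. coset_pair (fst z) (snd z) \<in> V}"
      using openin_continuous_map_preimage[OF coset_pair_continuous[of ?X]]
      by (simp add: coind_space_def dih_rcosets case_prod_unfold)
    then obtain W where W: "open W" "{z \<in> ?S. coset_pair (fst z) (snd z) \<in> V} = ?S \<inter> W"
      unfolding openin_open by blast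
    then have "W \<in> \<G>" "z \<in> W" using V z unfolding \<G>_def by blast+
    then show "z \<in> \<Union>\<G>" by blast
  qed
  moreover have "\<And>W. W \<in> \<G> \<Longrightarrow> open W" by (simp add: \<G>_def)
  ultimately obtain \<epsilon> where \<epsilon>: "0 < \<epsilon>" "\<And>z. z \<in> ?S \<Longrightarrow> \<exists>W\<in>\<G>. ball z \<epsilon> \<subseteq> W"
    using Heine_Borel_lemma by metis
  \<comment> \<open>Half of \<open>\<epsilon>\<close> for each coordinate, as the distance in the
    product is at most the sum of the two distances.\<close>
  obtain m where m: "1 / real (Suc m) < \<epsilon> / 2" using nat_approx_posE[of "\<epsilon> / 2"] \<epsilon>(1) by auto
  define K where "K = Suc m"
  have K: "K \<ge> 1" by (simp add: K_def)
  show ?thesis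
  proof (rule that[OF K])
    fix u v assume uv: "u \<in> ?X" "v \<in> ?X"
    then have "(lab K u, lab K v) \<in> ?S" using lab_in_X1 by simp
    from \<epsilon>(2)[OF this] obtain W where W: "W \<in> \<G>" "ball (lab K u, lab K v) \<epsilon> \<subseteq> W" by blast
    then obtain V where V: "V \<in> \<U>" "\<And>z. z \<in> ?S \<inter> W \<Longrightarrow> coset_pair (fst z) (snd z) \<in> V"
      unfolding \<G>_def by blast
    have "coset_pair u' v' \<in> V"
      if "u' \<in> ?X" "v' \<in> ?X" "lab K u' = lab K u" "lab K v' = lab K v" for u' v'
    proof -
      have "dist (lab K u) u' \<le> 1 / real K" "dist (lab K v) v' \<le> 1 / real K"
        using lab_dist[OF K, of u'] lab_dist[OF K, of v'] that by (simp_all add: dist_commute)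
      moreover have "dist (lab K u, lab K v) (u', v') \<le> dist (lab K u) u' + dist (lab K v) v'"
        unfolding dist_prod_def by (simp add: sqrt_sum_squares_le_sum)
      ultimately have "dist (lab K u, lab K v) (u', v') < \<epsilon>" using m by (simp add: K_def)
      then have "(u', v') \<in> ?S \<inter> W" using W(2) that by auto
      then show ?thesis using V(2) by fastforce
    qed
    then show "\<exists>V\<in>\<U>. \<forall>u'\<in>?X. \<forall>v'\<in>?X. lab K u' = lab K u \<longrightarrow> lab K v' = lab K v \<longrightarrow>
      coset_pair u' v' \<in> V" using V(1) by blast
  qed
qed

lemma coind_entropy_le:
  assumes cov: "open_cover coind_X \<U>"
  shows "cover_pattern_entropy coind_X dih_group coind_T \<U> \<le> ln 2"
proof -
  let ?X = "X1 a_inf x"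
  obtain K where K: "K \<ge> 1" and cell: "\<And>u v. u \<in> ?X \<Longrightarrow> v \<in> ?X \<Longrightarrow>
    \<exists>V\<in>\<U>. \<forall>u'\<in>?X. \<forall>v'\<in>?X. lab K u' = lab K u \<longrightarrow> lab K v' = lab K v \<longrightarrow> coset_pair u' v' \<in> V"
    using cover_labels[OF cov] by blast
  obtain C where C: "C > 0" "\<And>E. finite E \<Longrightarrow>
    finite (itinerary K E ` ?X) \<and> finite (itinerary K (uminus ` E) ` ?X) \<and>
    card (itinerary K E ` ?X) * card (itinerary K (uminus ` E) ` ?X) \<le> C * (card E + 1) ^ 4 * 2 ^ card E"
    using itineraries_pair_card[OF K] by blast
  show ?thesis
  proof (rule cover_pattern_entropy_le_ln2[OF cov, of "real C"])
    fix k :: nat and g assume g: "g \<in> {1..k} \<rightarrow> carrier dih_group"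
    \<comment> \<open>\<open>\<tau> i\<close> is the time at which \<open>g i\<close> observes the
      coordinate at \<open>dih_Z\<close>, whichever coset it is moved to; the other coordinate is
      observed at time \<open>- \<tau> i\<close>. Hence one set \<open>E\<close> of at most
      \<open>k\<close> times serves both coordinates.\<close>
    define \<tau> where "\<tau> i = (if snd (g i) = 0 then fst (g i) else - fst (g i))" for i
    define E where "E = \<tau> ` {1..k}"
    have E: "finite E" "card E \<le> k"
      unfolding E_def using card_image_le[OF finite_atLeastAtMost, of \<tau> 1 k] by simp_all
    define name where "name f = (itinerary K E (f dih_Z), itinerary K (uminus ` E) (f dih_C))" for f
    have sub: "name ` topspace coind_X \<subseteq> itinerary K E ` ?X \<times> itinerary K (uminus ` E) ` ?X"
      by (auto simp: name_def topspace_coind)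
    have fin: "finite (itinerary K E ` ?X \<times> itinerary K (uminus ` E) ` ?X)" using C(2)[OF E(1)] by blast
    have "pattern_number \<U> k g \<le> card (name ` topspace coind_X)"
    proof (rule pattern_number_le_names[OF cov g finite_subset[OF sub fin]])
      fix i f assume i: "i \<in> {1..k}" and f: "f \<in> topspace coind_X"
      have gc: "g i \<in> carrier dih_group" using g i by blast
      define h where "h f = coind_T (g i) f" for f
      have h: "h f' dih_Z \<in> ?X" "h f' dih_C \<in> ?X" "coset_pair (h f' dih_Z) (h f' dih_C) = h f'"
        if "f' \<in> topspace coind_X" for f'
        using coind_T_closed[OF gc that] coset_pair_eq[of "h f'" ?X]
        unfolding h_def topspace_coind by auto
      have same: "lab K (h f' dih_Z) = lab K (h f dih_Z) \<and> lab K (h f' dih_C) = lab K (h f dih_C)"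
        if "name f' = name f" for f'
      proof -
        have eq: "lab K (Tpow e (f' dih_Z)) = lab K (Tpow e (f dih_Z))"
            "lab K (Tpow (- e) (f' dih_C)) = lab K (Tpow (- e) (f dih_C))" if "e \<in> E" for e
        proof -
          have "itinerary K E (f' dih_Z) e = itinerary K E (f dih_Z) e"
            "itinerary K (uminus ` E) (f' dih_C) (- e) = itinerary K (uminus ` E) (f dih_C) (- e)"
            using \<open>name f' = name f\<close> by (simp_all add: name_def)
          then show "lab K (Tpow e (f' dih_Z)) = lab K (Tpow e (f dih_Z))"
            "lab K (Tpow (- e) (f' dih_C)) = lab K (Tpow (- e) (f dih_C))"
            using that by (simp_all add: itinerary_def)
        qed
        have "\<tau> i \<in> E" using i unfolding E_def by blast
        note eq_i = eq[OF this]
        show ?thesis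
          by (rule dih_carrierE[OF gc]; use eq_i in \<open>simp add: h_def coind_action_dih \<tau>_def\<close>)
      qed
      obtain V where V: "V \<in> \<U>" "\<And>u' v'. u' \<in> ?X \<Longrightarrow> v' \<in> ?X \<Longrightarrow> lab K u' = lab K (h f dih_Z) \<Longrightarrow>
        lab K v' = lab K (h f dih_C) \<Longrightarrow> coset_pair u' v' \<in> V" using cell[OF h(1,2)[OF f]] by blast
      have "coind_T (g i) f' \<in> V" if f': "f' \<in> topspace coind_X" "name f' = name f" for f'
        using V(2)[OF h(1,2)[OF f'(1)]] same[OF f'(2)] h(3)[OF f'(1)] by (simp add: h_def)
      then show "\<exists>V\<in>\<U>. \<forall>f'\<in>topspace coind_X. name f' = name f \<longrightarrow> coind_T (g i) f' \<in> V"
        using V(1) by blast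
    qed
    also have "\<dots> \<le> card (itinerary K E ` ?X \<times> itinerary K (uminus ` E) ` ?X)"
      by (rule card_mono[OF fin sub])
    also have "\<dots> \<le> C * (card E + 1) ^ 4 * 2 ^ card E" using C(2)[OF E(1)] by (simp add: card_cartesian_product)
    also have "\<dots> \<le> C * (k + 1) ^ 4 * 2 ^ k"
      using E(2) by (intro mult_mono power_mono power_increasing) auto
    finally have "real (pattern_number \<U> k g) \<le> real (C * (k + 1) ^ 4 * 2 ^ k)" by (simp only: of_nat_le_iff)
    then show "real (pattern_number \<U> k g) \<le> real C * (real k + 1) ^ 4 * 2 ^ k" by (simp add: add.commute)
  qed (use C(1) in simp)
qed

section \<open>Lower bound\<close>

definition separating_set :: "int \<Rightarrow> ((int \<times> int) set \<Rightarrow> real^2) set" where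
  "separating_set b = {f \<in> topspace coind_X. f dih_Z \<notin> U 1 b}"

lemma separating_cover: "open_cover coind_X {separating_set 0, separating_set 1}"
proof -
  have "openin coind_X (separating_set b)" for b
  proof -
    have "continuous_map coind_X (top_of_set (X1 a_inf x)) (\<lambda>f. f dih_Z)"
      unfolding coind_space_def dih_rcosets by (rule continuous_map_product_projection) simp
    then have "continuous_map coind_X euclidean (\<lambda>f. f dih_Z)"
      using continuous_map_in_subtopology by blast
    moreover have "openin euclidean (- U 1 b)" using U_nhd[of 1 b] by auto
    ultimately have "openin coind_X {f \<in> topspace coind_X. f dih_Z \<in> - U 1 b}"
      by (rule openin_continuous_map_preimage)
    then show ?thesis by (simp add: separating_set_def)
  qed
  moreover have "U 1 0 \<inter> U 1 1 = {}" by (rule U_disjoint) auto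
  then have "separating_set 0 \<union> separating_set 1 = topspace coind_X" unfolding separating_set_def by blast
  ultimately show ?thesis unfolding open_cover_def by simp
qed

text \<open>The element \<open>(n k i, 0)\<close> moves \<open>x k s 0\<close> in the first
  coordinate to \<open>x k s (n k i)\<close>, which lies in the cell of the letter
  \<open>s i\<close>. This excludes one of the two members of the cover, so a joined set fixes all
  these letters, and \<open>2 ^ k\<close> words need \<open>2 ^ k\<close> joined sets.\<close>

lemma separating_entropy_ge:
  "ln 2 \<le> cover_pattern_entropy coind_X dih_group coind_T {separating_set 0, separating_set 1}"
proof (rule cover_pattern_entropy_ge_ln2[OF separating_cover])
  fix k :: nat assume k: "k \<ge> 1"
  define g where "g i = (n k i, 0 :: int)" for i
  have g: "g \<in> {1..k} \<rightarrow> carrier dih_group" by (auto simp: g_def dih_carrier)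
  \<comment> \<open>Words have \<open>k + 1\<close> letters. The one at \<open>0\<close> is fixed,
    since only the times \<open>n k 1\<close> to \<open>n k k\<close> are observed.\<close>
  define w where "w S = (\<lambda>q\<in>{0..k}. if q = 0 then 0 else S q)" for S :: "nat \<Rightarrow> int"
  define F where "F S = coset_pair (x k (w S) 0) a_inf" for S
  let ?I = "{1..k} \<rightarrow>\<^sub>E {0, 1 :: int}"
  have w: "w S \<in> words k" if "S \<in> ?I" for S
    using that unfolding words_def w_def by (auto simp: PiE_iff)
  have F_in: "F S \<in> topspace coind_X" if "S \<in> ?I" for S
    using in_X1(1) in_X1(3)[OF k w[OF that]] unfolding F_def topspace_coind coset_pair_in by blast
  have inj: "inj_on F ?I"
  proof (rule inj_onI)
    fix S S' assume S: "S \<in> ?I" "S' \<in> ?I" "F S = F S'"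
    then have "x k (w S) 0 = x k (w S') 0" by (metis F_def coset_pair_simps(1))
    then have "w S = w S'" using x_eq_x[OF k w[OF S(1)] k w[OF S(2)]] by blast
    then have "w S q = w S' q" for q by simp
    then have "S q = S' q" if "q \<in> {1..k}" for q using that by (auto simp: w_def dest: meta_spec[of _ q])
    then show "S = S'" using S by (intro PiE_ext) auto
  qed
  have "card (F ` ?I) \<le> pattern_number {separating_set 0, separating_set 1} k g"
  proof (rule pattern_number_ge_separated[OF separating_cover g])
    show "F ` ?I \<subseteq> topspace coind_X" using F_in by blast
    fix W f f' assume W: "W \<in> pattern_cover {separating_set 0, separating_set 1} k g"
      and f: "f \<in> F ` ?I \<inter> W" and f': "f' \<in> F ` ?I \<inter> W"
    obtain V where V: "\<And>i. i \<in> {1..k} \<Longrightarrow> V i \<in> {separating_set 0, separating_set 1}"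
      "\<And>f i. f \<in> W \<Longrightarrow> f \<in> topspace coind_X \<Longrightarrow> i \<in> {1..k} \<Longrightarrow> coind_T (g i) f \<in> V i"
      using pattern_coverE[OF W g separating_cover] by blast
    have avoid: "V i \<noteq> separating_set (S i)" if S: "S \<in> ?I" "F S \<in> W" and i: "i \<in> {1..k}" for S i
    proof
      assume "V i = separating_set (S i)"
      then have "coind_T (g i) (F S) \<in> separating_set (S i)" using V(2)[OF S(2) F_in[OF S(1)] i] by simp
      then have "Tpow (n k i) (x k (w S) 0) \<notin> U 1 (S i)"
        by (simp add: separating_set_def g_def coind_action_dih F_def)
      then have "x k (w S) (n k i) \<notin> U 1 (S i)"
        using Tpow_orbit[OF orbits(3)[OF k w[OF S(1)]]] by simp
      moreover have "x k (w S) (n k i) \<in> U k (w S i)"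
        using x_near[OF k w[OF S(1)], of i 0 "n k i"] i n_1_ge[OF k] by simp
      moreover have "w S i = S i" using i by (simp add: w_def)
      ultimately show False using U_mono[OF k, of "S i"] by auto
    qed
    obtain S S' where S: "S \<in> ?I" "f = F S" "S' \<in> ?I" "f' = F S'" using f f' by blast
    have "S i = S' i" if i: "i \<in> {1..k}" for i
    proof -
      have "S i \<in> {0, 1}" "S' i \<in> {0, 1}" using S i by auto
      then show ?thesis using avoid[OF S(1) _ i] avoid[OF S(3) _ i] V(1)[OF i] f f' S by auto
    qed
    then have "S = S'" using S by (intro PiE_ext) auto
    then show "f = f'" using S by simp
  qed
  moreover have "card (F ` ?I) = 2 ^ k" using card_image[OF inj] by (simp add: card_PiE numeral_2_eq_2)
  ultimately show "\<exists>g\<in>{1..k} \<rightarrow> carrier dih_group.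
      2 ^ k \<le> pattern_number {separating_set 0, separating_set 1} k g" using g by auto
qed

lemma coind_entropy: "max_pattern_entropy coind_X dih_group coind_T = ereal (ln 2)"
proof (rule antisym)
  show "max_pattern_entropy coind_X dih_group coind_T \<le> ereal (ln 2)"
    unfolding max_pattern_entropy_def using coind_entropy_le by (intro SUP_least) auto
  show "ereal (ln 2) \<le> max_pattern_entropy coind_X dih_group coind_T"
    unfolding max_pattern_entropy_def using separating_cover separating_entropy_ge
    by (intro SUP_upper2[of "{separating_set 0, separating_set 1}"]) auto
qed

end

theorem theorem3p11:
  fixes a :: "int \<Rightarrow> real^2" and a_inf :: "real^2"
    and n :: "nat \<Rightarrow> nat \<Rightarrow> int"
    and U :: "nat \<Rightarrow> int \<Rightarrow> (real^2) set" and U_inf :: "nat \<Rightarrow> (real^2) set"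
    and j p :: "nat \<Rightarrow> (nat \<Rightarrow> int) \<Rightarrow> nat \<Rightarrow> int"
    and x :: "nat \<Rightarrow> (nat \<Rightarrow> int) \<Rightarrow> int \<Rightarrow> real^2"
    and T :: "real^2 \<Rightarrow> real^2"
  assumes "X1_construction a a_inf n U U_inf j p x T"
  shows "max_pattern_entropy
           (coind_space dih_group dih_Z (top_of_set (X1 a_inf x)))
           dih_group
           (coind_action dih_group dih_Z dih_section (dih_Z_action (X1 a_inf x) T))
         = ereal (ln 2)"
  by (rule X1_construction.coind_entropy[OF assms])

end
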